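(* Let $\mu$ be a probability measure on $\mathbb{R}^n$ with density $e^{-V}$, where $V:\mathbb{R}^n\to\mathbb{R}$ is $\mathcal C^2$ with $\mathrm{Hess}(V)\ge R\,\mathrm{Id}_n$ for some $R>0$. Then $$\mathrm{Ent}_\mu(f^2)\le n(s-1-\log s)+\frac{1}{2R}\int\Big|(1-s)\nabla V+2s\frac{\nabla f}{f}\Big|^2 f^2\,d\mu$$ for any $s>0$ and any $\mathcal C^1$, non-negative and compactly supported function $f$ on $\mathbb{R}^n$ such that $\int f^2\,d\mu=1$.
   Context: Densities are with respect to Lebesgue measure. $\mathrm{Hess}(V)\ge R\,\mathrm{Id}_n$ is meant pointwise, in the sense of symmetric matrices. When $\int f^2d\mu=1$, $\mathrm{Ent}_\mu(f^2)=\int f^2\log(f^2)\,d\mu$ (with $0\log 0=0$). The integrand $\big|(1-s)\nabla V+2s\frac{\nabla f}{f}\big|^2f^2$ is understood as $|(1-s)f\nabla V+2s\nabla f|^2$ (which vanishes where $f=0$). *)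

theory Defs
  imports "HOL-Probability.Probability"
begin

definition grad :: "(real ^ 'n \<Rightarrow> real) \<Rightarrow> real ^ 'n \<Rightarrow> real ^ 'n" where
  "grad f x = (\<chi> i. frechet_derivative f (at x) (axis i 1))"

lemma GDERIV_grad:
  assumes "f differentiable at x"
  shows "GDERIV f x :> grad f x"
proof -
  let ?D = "frechet_derivative f (at x)"
  have D: "(f has_derivative ?D) (at x)"
    using assms by (simp add: frechet_derivative_works)
  then have lin: "linear ?D"
    by (rule has_derivative_linear)
  have "?D h = h \<bullet> grad f x" for h
  proof -
    have "?D h = ?D (\<Sum>i\<in>UNIV. h $ i *\<^sub>R axis i 1)"
      using basis_expansion[of h] by (simp add: scalar_mult_eq_scaleR)
    also have "\<dots> = (\<Sum>i\<in>UNIV. h $ i * ?D (axis i 1))"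
      using lin by (simp add: linear_sum linear_cmul)
    finally show ?thesis
      by (simp add: grad_def inner_vec_def)
  qed
  then have "?D = (\<lambda>h. h \<bullet> grad f x)" by auto
  with D show ?thesis
    by (simp add: gderiv_def)
qed

definition Hess :: "(real ^ 'n \<Rightarrow> real) \<Rightarrow> real ^ 'n \<Rightarrow> real ^ 'n ^ 'n" where
  "Hess f x = matrix (frechet_derivative (grad f) (at x))"

definition C1 :: "(real ^ 'n \<Rightarrow> real) \<Rightarrow> bool" where
  "C1 f \<longleftrightarrow> (\<forall>x. f differentiable at x) \<and> continuous_on UNIV (grad f)"

definition C2 :: "(real ^ 'n \<Rightarrow> real) \<Rightarrow> bool" where
  "C2 f \<longleftrightarrow> C1 f \<and> (\<forall>x. grad f differentiable at x) \<and> continuous_on UNIV (Hess f)"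

text \<open>
  The order on symmetric matrices. Symmetry is not part of the definition: it is applied only
  to the Hessian of a \<^term>\<open>C2\<close> function and to a multiple of the identity.
\<close>

definition loewner_le :: "real ^ 'n ^ 'n \<Rightarrow> real ^ 'n ^ 'n \<Rightarrow> bool" where
  "loewner_le A B \<longleftrightarrow> (\<forall>v. v \<bullet> (A *v v) \<le> v \<bullet> (B *v v))"

definition compactly_supported :: "(real ^ 'n \<Rightarrow> real) \<Rightarrow> bool" where
  "compactly_supported f \<longleftrightarrow> compact (closure {x. f x \<noteq> 0})"

definition Ent :: "'a measure \<Rightarrow> ('a \<Rightarrow> real) \<Rightarrow> real" where
  "Ent M g = (\<integral>x. g x * ln (g x) \<partial>M) - (\<integral>x. g x \<partial>M) * ln (\<integral>x. g x \<partial>M)"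

lemma Ent_normalized:
  assumes "(\<integral>x. g x \<partial>M) = 1"
  shows "Ent M g = (\<integral>x. g x * ln (g x) \<partial>M)"
  using assms by (simp add: Ent_def)

end

theory Submission
  imports Defs
begin

text \<open>
  The proof is by mass transport. Let \<open>F = f\<^sup>2 exp (- V)\<close> and let \<open>T\<close> be a map that transports \<open>F\<close> to
  \<open>exp (- V)\<close>. The change of variables formula reads
  \<open>ln (f\<^sup>2) x = V x - V (T x) + ln (det (DT x))\<close>. With the displacement \<open>\<theta> = T x - x\<close>, the lower
  bound on the Hessian gives
  \<open>V x - V (T x) \<le> - \<nabla>V x \<bullet> \<theta> - R / 2 * |\<theta>|\<^sup>2\<close>.
  If \<open>DT\<close> is triangular with positive diagonal entries \<open>d i\<close>, the logarithm of its determinant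
  is controlled by the trace, as \<open>ln (d i) \<le> s * d i - 1 - ln s\<close>; the trace is \<open>n + div \<theta>\<close>, which
  produces the constant \<open>n (s - 1 - ln s)\<close>. Integrate against \<open>F\<close>. Integration by parts replaces
  the integral of \<open>F * div \<theta>\<close> by that of \<open>- \<nabla>F \<bullet> \<theta>\<close>, and the remaining integrand with respect to
  \<open>\<mu>\<close> is \<open>- f * (w \<bullet> \<theta>) - R / 2 * f\<^sup>2 * |\<theta>|\<^sup>2\<close> with \<open>w = (1 - s) f \<nabla>V + 2 s \<nabla>f\<close>. It is at most
  \<open>|w|\<^sup>2 / (2 * R)\<close> for every value of \<open>\<theta>\<close>.

  For \<open>T\<close> the Knothe map is used, which rearranges one coordinate after the other. It comes from
  one-dimensional distribution functions alone, its diagonal entries are quotients of marginals,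
  and each of them enters an integration by parts in its own direction only, which is a
  one-dimensional statement on each line (lemmas \<open>knothe_map_exists\<close> and \<open>fiber_integration_by_parts\<close>).

  The target is first restricted to a large cube. Then the map is bounded, and the boundary
  terms vanish because \<open>F\<close> does so on the boundary of the cube (\<open>entropy_le_transport\<close>). The
  inequality obtained for the cube, \<open>log_sobolev_on_cube\<close>, differs from the desired one only by the
  logarithm of the mass of the cube, which tends to \<open>0\<close> as the cube grows.

  Marginals are taken on the type \<open>'n \<Rightarrow> real\<close>, where a coordinate can be changed by function
  update and Fubini is available for products over index sets; \<open>integral_cube\<close> translates the
  result back to \<open>real ^ 'n\<close>.
\<close>

section \<open>Lebesgue measure on a cube and marginals\<close>

definition seg :: "real \<Rightarrow> real measure" where
  "seg K = density lborel (indicator {-K..K})"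

lemma sets_seg [measurable_cong, simp]: "sets (seg K) = sets borel"
  by (simp add: seg_def)

lemma space_seg [simp]: "space (seg K) = UNIV"
  by (simp add: seg_def)

lemma measurable_seg [simp]: "measurable (seg K) M = measurable borel M"
  by (rule measurable_cong_sets) simp_all

lemma emeasure_seg: "A \<in> sets borel \<Longrightarrow> emeasure (seg K) A = emeasure lborel (A \<inter> {-K..K})"
  by (simp add: seg_def emeasure_density ac_simps flip: indicator_inter_arith)

lemma seg_eq_real_density: "seg K = density lborel (\<lambda>x. ennreal (indicat_real {-K..K} x))"
  by (simp add: seg_def ennreal_indicator)

lemma finite_measure_seg: "finite_measure (seg K)"
  by (rule finite_measureI) (simp add: emeasure_seg emeasure_lborel_Icc_eq)

interpretation seg: finite_measure "seg K" for K
  by (rule finite_measure_seg)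

interpretation segs: product_sigma_finite "\<lambda>_. seg K" for K
  by standard

lemma AE_seg: "AE t in seg K. \<bar>t\<bar> \<le> K"
  unfolding seg_def by (subst AE_density) (auto simp: abs_le_iff indicator_def split: if_splits)

lemma finite_measure_PiM_seg: "finite_measure (PiM J (\<lambda>_::'n::finite. seg K))"
proof (rule finite_measureI)
  have "emeasure (PiM J (\<lambda>_::'n. seg K)) (space (PiM J (\<lambda>_. seg K))) = (\<Prod>i\<in>J. emeasure (seg K) UNIV)"
    unfolding space_PiM space_seg by (subst segs.emeasure_PiM) auto
  then show "emeasure (PiM J (\<lambda>_::'n. seg K)) (space (PiM J (\<lambda>_. seg K))) \<noteq> \<infinity>"
    by (simp add: emeasure_seg emeasure_lborel_Icc_eq ennreal_power power_eq_top_ennreal zero_power)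
qed

lemma AE_PiM_seg: "AE x in PiM J (\<lambda>_::'n::finite. seg K). \<forall>i\<in>J. \<bar>x i\<bar> \<le> K"
proof (rule AE_finite_allI)
  fix i assume i: "i \<in> J"
  let ?N = "Pi\<^sub>E J (\<lambda>j. if j = i then - {-K..K} else UNIV)"
  have "emeasure (PiM J (\<lambda>_. seg K)) ?N = (\<Prod>j\<in>J. emeasure (seg K) (if j = i then - {-K..K} else UNIV))"
    by (intro segs.emeasure_PiM) auto
  also have "\<dots> = 0"
    using i by (intro prod_zero) (auto intro!: bexI[of _ i] simp: emeasure_seg)
  finally have "?N \<in> null_sets (PiM J (\<lambda>_. seg K))"
    by (intro null_setsI sets_PiM_I_finite) auto
  then show "AE x in PiM J (\<lambda>_. seg K). \<bar>x i\<bar> \<le> K"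
    by (rule AE_I') (auto simp: space_PiM PiE_def Pi_def abs_le_iff)
qed simp

lemma sets_PiM_seg_UNIV:
  "sets (PiM UNIV (\<lambda>_::'n::finite. seg K)) = sets (borel :: ('n \<Rightarrow> real) measure)"
proof -
  have "sets (PiM UNIV (\<lambda>_::'n. seg K)) = sets (PiM UNIV (\<lambda>_::'n. borel :: real measure))"
    by (intro sets_PiM_cong) auto
  then show ?thesis by (simp add: sets_PiM_equal_borel)
qed

text \<open>
  The product measure and the Borel measure of the function space have the same sets by
  \<open>sets_PiM_seg_UNIV\<close> but different measurability rules; everything below is proved for
  \<^const>\<open>borel\<close>, where continuity is available, and transported by this equivalence.
\<close>

lemma borel_measurable_cube:
  fixes f :: "('n::finite \<Rightarrow> real) \<Rightarrow> real"
  shows "f \<in> borel_measurable borel \<longleftrightarrow> f \<in> borel_measurable (PiM UNIV (\<lambda>_. seg K))"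
  by (intro arg_cong[where f="\<lambda>S. f \<in> S"] measurable_cong_sets) (auto simp: sets_PiM_seg_UNIV)

lemma measurable_coords:
  fixes f :: "'a \<Rightarrow> 'n::finite \<Rightarrow> real"
  assumes "\<And>i. (\<lambda>x. f x i) \<in> borel_measurable M"
  shows "f \<in> measurable M borel"
proof -
  have "f \<in> measurable M (PiM UNIV (\<lambda>_. borel))"
    using assms by (intro measurable_PiM_single') auto
  then show ?thesis
    using measurable_cong_sets[OF refl sets_PiM_equal_borel] by blast
qed

lemma measurable_coord [measurable]:
  "(\<lambda>x :: 'n::finite \<Rightarrow> real. x i) \<in> borel_measurable borel"
  by (intro borel_measurable_continuous_onI continuous_on_product_coordinates)

lemma continuous_on_fun_upd_compose:
  fixes f :: "'a::topological_space \<Rightarrow> 'n \<Rightarrow> real"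
  assumes "continuous_on S f" "continuous_on S g"
  shows "continuous_on S (\<lambda>x. (f x)(a := g x))"
proof (rule continuous_on_coordinatewise_then_product)
  fix i
  show "continuous_on S (\<lambda>x. ((f x)(a := g x)) i)"
    using assms by (cases "i = a") (auto simp: continuous_on_product_then_coordinatewise)
qed

text \<open>
  The coordinates in \<open>J\<close> are integrated out. The result is still a function of all coordinates,
  constant in those of \<open>J\<close>; in this way all marginals of a function have the same type and an
  induction over sets of coordinates can be stated without changing the dimension.
\<close>

definition marg :: "real \<Rightarrow> 'n set \<Rightarrow> (('n::finite \<Rightarrow> real) \<Rightarrow> real) \<Rightarrow> ('n \<Rightarrow> real) \<Rightarrow> real" where
  "marg K J F x = (\<integral>y. F (\<lambda>j. if j \<in> J then y j else x j) \<partial>PiM J (\<lambda>_. seg K))"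

lemma marg_empty: "marg K {} F = F"
proof
  fix x
  interpret P: prob_space "PiM {} (\<lambda>_::'n. seg K)" by (intro prob_spaceI) (simp add: space_PiM)
  show "marg K {} F x = F x" by (simp add: marg_def P.prob_space)
qed

lemma marg_UNIV: "marg K UNIV F x = (\<integral>y. F y \<partial>PiM UNIV (\<lambda>_. seg K))"
  by (simp add: marg_def)

lemma marg_cong:
  "(\<And>j. j \<notin> J \<Longrightarrow> x j = y j) \<Longrightarrow> marg K J F x = marg K J F y"
  unfolding marg_def by (intro Bochner_Integration.integral_cong refl arg_cong[where f=F]) auto

lemma measurable_merge_fun:
  fixes F :: "('n::finite \<Rightarrow> real) \<Rightarrow> real"
  assumes "continuous_on UNIV F"
  shows "(\<lambda>y. F (\<lambda>j. if j \<in> J then y j else x j)) \<in> borel_measurable (PiM J (\<lambda>_. seg K))"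
proof -
  have "(\<lambda>y j. if j \<in> J then y j else x j) \<in> measurable (PiM J (\<lambda>_. seg K)) borel"
  proof (rule measurable_coords)
    fix i
    have "(\<lambda>y. y i) \<in> borel_measurable (PiM J (\<lambda>_::'n. seg K))" if "i \<in> J"
      using measurable_component_singleton[OF that, of "\<lambda>_. seg K"]
      unfolding measurable_cong_sets[OF refl sets_seg] .
    then show "(\<lambda>y. if i \<in> J then y i else x i) \<in> borel_measurable (PiM J (\<lambda>_. seg K))"
      by (cases "i \<in> J") auto
  qed
  from measurable_compose[OF this borel_measurable_continuous_onI[OF assms]] show ?thesis .
qed

context
  fixes F :: "('n::finite \<Rightarrow> real) \<Rightarrow> real" and B :: real
  assumes cont: "continuous_on UNIV F" and bdd: "\<And>x. \<bar>F x\<bar> \<le> B"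
begin

lemma integrable_merge_fun:
  "integrable (PiM J (\<lambda>_. seg K)) (\<lambda>y. F (\<lambda>j. if j \<in> J then y j else x j))"
proof -
  interpret P: finite_measure "PiM J (\<lambda>_::'n. seg K)" by (rule finite_measure_PiM_seg)
  show ?thesis
    using bdd by (intro P.integrable_const_bound[of _ B] measurable_merge_fun cont) auto
qed

lemma continuous_on_marg: "continuous_on UNIV (marg K J F)"
  unfolding continuous_on_sequentially
proof (intro allI impI ballI, elim conjE)
  fix X :: "nat \<Rightarrow> 'n \<Rightarrow> real" and x
  assume X: "X \<longlonglongrightarrow> x"
  interpret P: finite_measure "PiM J (\<lambda>_::'n. seg K)" by (rule finite_measure_PiM_seg)
  show "(marg K J F \<circ> X) \<longlonglongrightarrow> marg K J F x"
    unfolding marg_def comp_def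
  proof (rule integral_dominated_convergence[where w="\<lambda>_. B"])
    show "AE y in PiM J (\<lambda>_. seg K). (\<lambda>n. F (\<lambda>j. if j \<in> J then y j else X n j)) \<longlonglongrightarrow>
        F (\<lambda>j. if j \<in> J then y j else x j)"
    proof (rule AE_I2)
      fix y
      have "continuous_on UNIV (\<lambda>x. F (\<lambda>j. if j \<in> J then y j else x j))"
      proof (intro continuous_on_compose2[OF cont] continuous_on_coordinatewise_then_product)
        show "continuous_on UNIV (\<lambda>x. if i \<in> J then y i else x i)" for i
          by (cases "i \<in> J") auto
      qed auto
      then show "(\<lambda>n. F (\<lambda>j. if j \<in> J then y j else X n j)) \<longlonglongrightarrow> F (\<lambda>j. if j \<in> J then y j else x j)"
        using X by (auto simp: continuous_on_sequentially comp_def)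
    qed
  qed (use bdd in \<open>auto intro!: measurable_merge_fun cont\<close>)
qed

lemma marg_insert:
  assumes "a \<notin> J"
  shows "marg K (insert a J) F x = (\<integral>t. marg K J F (x(a := t)) \<partial>seg K)"
proof -
  interpret P: finite_measure "PiM J (\<lambda>_::'n. seg K)" by (rule finite_measure_PiM_seg)
  interpret Q: pair_sigma_finite "PiM J (\<lambda>_::'n. seg K)" "seg K" ..
  interpret R: finite_measure "PiM J (\<lambda>_::'n. seg K) \<Otimes>\<^sub>M seg K"
    by (intro finite_measure_pair_measure finite_measure_PiM_seg finite_measure_seg)
  let ?h = "\<lambda>y t. F (\<lambda>j. if j \<in> J then y j else (x(a := t)) j)"
  have "(\<lambda>p. (\<lambda>j. if j \<in> J then fst p j else (x(a := snd p)) j)) \<in> 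
      measurable (PiM J (\<lambda>_::'n. seg K) \<Otimes>\<^sub>M seg K) borel" 
  proof (rule measurable_coords)
    fix i
    have "(\<lambda>p. fst p i) \<in> borel_measurable (PiM J (\<lambda>_::'n. seg K) \<Otimes>\<^sub>M seg K)" if "i \<in> J"
      using measurable_compose[OF measurable_fst measurable_component_singleton[OF that, of "\<lambda>_. seg K"]]
      unfolding measurable_cong_sets[OF refl sets_seg] .
    then show "(\<lambda>p. if i \<in> J then fst p i else (x(a := snd p)) i)
        \<in> borel_measurable (PiM J (\<lambda>_::'n. seg K) \<Otimes>\<^sub>M seg K)"
      by (cases "i \<in> J"; cases "i = a") auto
  qed
  from measurable_compose[OF this borel_measurable_continuous_onI[OF cont]]
  have m: "(\<lambda>(y,t). ?h y t) \<in> borel_measurable (PiM J (\<lambda>_::'n. seg K) \<Otimes>\<^sub>M seg K)"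
    by (simp add: case_prod_beta)
  have i: "integrable (PiM J (\<lambda>_::'n. seg K) \<Otimes>\<^sub>M seg K) (\<lambda>(y,t). ?h y t)"
    using bdd by (intro R.integrable_const_bound[of _ B] m) auto
  have "marg K (insert a J) F x = (\<integral>y. (\<integral>t. F (\<lambda>j. if j \<in> insert a J then (y(a := t)) j else x j) \<partial>seg K) \<partial>PiM J (\<lambda>_. seg K))"
    unfolding marg_def using assms
    by (intro segs.product_integral_insert integrable_merge_fun) auto
  also have "\<dots> = (\<integral>y. (\<integral>t. ?h y t \<partial>seg K) \<partial>PiM J (\<lambda>_. seg K))"
    using assms by (intro Bochner_Integration.integral_cong refl arg_cong[where f=F]) auto
  also have "\<dots> = (\<integral>t. marg K J F (x(a := t)) \<partial>seg K)"
    unfolding marg_def by (rule Q.Fubini_integral[OF i, symmetric])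
  finally show ?thesis .
qed

end

lemma marg_nonneg: "(\<And>x. 0 \<le> F x) \<Longrightarrow> 0 \<le> marg K J F x"
  by (simp add: marg_def)

lemma integral_seg:
  fixes h :: "real \<Rightarrow> real"
  assumes h: "continuous_on {-K..K} h" and m: "h \<in> borel_measurable borel"
  shows "integrable (seg K) h" "(\<integral>t. h t \<partial>seg K) = integral {-K..K} h"
proof -
  have si: "set_integrable lborel {-K..K} h" by (rule borel_integrable_atLeastAtMost') fact
  then show "integrable (seg K) h"
    using m si unfolding seg_eq_real_density set_integrable_def
    by (subst integrable_density) auto
  show "(\<integral>t. h t \<partial>seg K) = integral {-K..K} h"
    using m set_borel_integral_eq_integral(2)[OF si] unfolding seg_eq_real_density set_lebesgue_integral_def
    by (subst integral_density) auto
qed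

lemma continuous_fiber:
  fixes F :: "('n::finite \<Rightarrow> real) \<Rightarrow> real"
  assumes "continuous_on UNIV F"
  shows "continuous_on S (\<lambda>t. F (x(a := t)))" 
  by (intro continuous_on_compose2[OF assms] continuous_on_fun_upd_compose continuous_intros) auto

text \<open>
  Positivity at one point of the cube passes to every marginal there: by continuity, each of the
  successive one-dimensional integrals of a nonnegative function that is positive somewhere on
  the segment is positive. This is why the conditional densities used to build the transport
  map are well defined wherever the source density does not vanish.
\<close>

lemma marg_pos:
  fixes F :: "('n::finite \<Rightarrow> real) \<Rightarrow> real"
  assumes cont: "continuous_on UNIV F" and bdd: "\<And>x. \<bar>F x\<bar> \<le> B" and nn: "\<And>x. 0 \<le> F x"
    and "0 < K" and "finite J" and "F x > 0" and "\<And>j. j \<in> J \<Longrightarrow> \<bar>x j\<bar> \<le> K"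
  shows "marg K J F x > 0"
  using \<open>finite J\<close> assms(6,7)
proof (induction J)
  case empty
  then show ?case by (simp add: marg_empty)
next
  case (insert a J)
  let ?h = "\<lambda>t. marg K J F (x(a := t))"
  have c: "continuous_on S ?h" for S
    by (intro continuous_fiber continuous_on_marg[OF cont bdd])
  have pos: "?h (x a) > 0" using insert by simp
  have "integral {-K..K} ?h \<noteq> 0"
  proof
    assume "integral {-K..K} ?h = 0"
    then have "(?h has_integral 0) (cbox (-K) K)"
      using integrable_continuous_real[OF c] by (metis cbox_interval integrable_integral)
    then have "?h (x a) = 0"
      using insert.prems(2)[of a] \<open>0 < K\<close>
      by (intro has_integral_0_cbox_imp_0[of "-K" K ?h]) (auto intro!: c marg_nonneg nn)
    with pos show False by simp
  qed
  moreover have "integral {-K..K} ?h \<ge> 0"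
    by (intro integral_nonneg integrable_continuous_real c marg_nonneg nn)
  ultimately show ?case
    by (simp add: marg_insert[OF cont bdd insert.hyps(2)] integral_seg[OF c borel_measurable_continuous_onI[OF c]])
qed

section \<open>Transport in one dimension\<close>

lemma antiderivative_strict_mono:
  fixes g :: "real \<Rightarrow> real"
  assumes g: "continuous_on {a..b} g" "\<And>t. 0 < g t" and "a \<le> s" "s < t" "t \<le> b"
  shows "integral {a..s} g < integral {a..t} g"
proof -
  have gi: "g integrable_on {a..t}" "continuous_on {s..t} g"
    using assms by (auto intro!: integrable_continuous_real intro: continuous_on_subset)
  then have st: "(g has_integral integral {s..t} g) (cbox s t)"
    using integrable_continuous_real by fastforce
  have "integral {s..t} g \<noteq> 0"
  proof
    assume "integral {s..t} g = 0"
    then have "g s = 0" using st gi assms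
      by (intro has_integral_0_cbox_imp_0[of s t g]) (auto intro: less_imp_le)
    then show False using g(2)[of s] by simp
  qed
  moreover have "0 \<le> integral {s..t} g"
    using g(2) gi by (intro integral_nonneg integrable_continuous_real) (auto intro: less_imp_le)
  moreover have "integral {a..s} g + integral {s..t} g = integral {a..t} g"
    using assms gi by (intro Henstock_Kurzweil_Integration.integral_combine) auto
  ultimately show ?thesis by linarith
qed

lemma inverse_cdf_exists:
  fixes g :: "real \<Rightarrow> real"
  assumes "continuous_on {a..b} g" "a \<le> b" "0 \<le> c" "c \<le> integral {a..b} g"
  shows "\<exists>y\<in>{a..b}. integral {a..y} g = c"
proof -
  have "continuous_on {a..b} (\<lambda>y. integral {a..y} g)"
    using assms by (intro indefinite_integral_continuous_1 integrable_continuous_real) auto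
  then show ?thesis
    using IVT'[of "\<lambda>y. integral {a..y} g" a c b] assms by auto
qed

text \<open>
  The increasing rearrangement \<open>\<phi>\<close> of the density \<open>u\<close> onto \<open>g\<close> satisfies the one-dimensional
  Monge-Ampere equation, by the chain rule for the inverse of the distribution function of \<open>g\<close>.
  The point \<open>\<phi> t\<close> can be an end of the segment although \<open>t\<close> is interior, namely when \<open>u\<close> has no
  mass near the end; as \<open>g\<close> is positive on the whole line, its distribution function can be
  inverted on a slightly larger segment, and no one-sided derivatives occur.
\<close>

lemma has_derivative_inverse_cdf:
  fixes g u \<phi> :: "real \<Rightarrow> real"
  assumes "0 < K" and g: "continuous_on UNIV g" "\<And>t. 0 < g t"
    and u: "continuous_on {-K..K} u" and "0 < U"
    and \<phi>: "\<And>t. t \<in> {-K..K} \<Longrightarrow> \<phi> t \<in> {-K..K}"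
      "\<And>t. t \<in> {-K..K} \<Longrightarrow> U * integral {-K..\<phi> t} g = C * integral {-K..t} u"
  shows "continuous_on {-K..K} \<phi>"
    and "\<And>t. t \<in> {-K<..<K} \<Longrightarrow> (\<phi> has_real_derivative C * u t / (U * g (\<phi> t))) (at t)"
proof -
  define S where "S = {-K-1..K+1}"
  define \<Gamma> where "\<Gamma> y = integral {-K-1..y} g" for y
  define c where "c t = \<Gamma> (-K) + C / U * integral {-K..t} u" for t
  define \<psi> where "\<psi> = the_inv_into S \<Gamma>"
  have gS: "continuous_on S' g" for S' using g(1) continuous_on_subset by blast
  have \<Gamma>_cont: "continuous_on S \<Gamma>"
    unfolding S_def \<Gamma>_def by (intro indefinite_integral_continuous_1 integrable_continuous_real gS)
  have mono: "\<Gamma> y < \<Gamma> z" if "y \<in> S" "z \<in> S" "y < z" for y z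
    unfolding \<Gamma>_def using that S_def by (intro antiderivative_strict_mono[of _ "K+1"] gS g(2)) auto
  have inj: "inj_on \<Gamma> S"
    by (rule linorder_inj_onI') (use mono in force)
  have \<Gamma>_deriv: "(\<Gamma> has_real_derivative g y) (at y)" if "y \<in> {-K-1<..<K+1}" for y
  proof -
    have "(\<Gamma> has_real_derivative g y) (at y within {-K-1..K+1})"
      unfolding \<Gamma>_def using that by (intro integral_has_real_derivative gS) auto
    moreover have "at y within {-K-1..K+1} = at y"
      using that by (intro at_within_interior) auto
    ultimately show ?thesis by simp
  qed
  have \<psi>_cont: "continuous_on (\<Gamma> ` S) \<psi>"
    unfolding \<psi>_def using \<Gamma>_cont inj by (intro continuous_on_inv_into) (auto simp: S_def)
  have \<phi>S: "\<phi> t \<in> {-K-1<..<K+1}" "\<phi> t \<in> S" if "t \<in> {-K..K}" for t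
    using \<phi>(1)[OF that] by (auto simp: S_def)
  have \<Gamma>\<phi>: "\<Gamma> (\<phi> t) = c t" if "t \<in> {-K..K}" for t
  proof -
    have "\<Gamma> (\<phi> t) = \<Gamma> (-K) + integral {-K..\<phi> t} g"
      unfolding \<Gamma>_def using \<phi>(1)[OF that] \<open>0 < K\<close>
      by (intro Henstock_Kurzweil_Integration.integral_combine[symmetric] integrable_continuous_real gS) auto
    then show ?thesis
      using \<phi>(2)[OF that] \<open>0 < U\<close> by (simp add: c_def field_simps)
  qed
  have \<phi>\<psi>: "\<phi> t = \<psi> (c t)" if "t \<in> {-K..K}" for t
    unfolding \<psi>_def using \<Gamma>\<phi>[OF that] \<phi>S(2)[OF that] inj by (metis the_inv_into_f_f)
  have c_cont: "continuous_on {-K..K} c"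
    unfolding c_def by (intro continuous_intros indefinite_integral_continuous_1 integrable_continuous_real u)
  have "continuous_on {-K..K} (\<lambda>t. \<psi> (c t))"
    by (rule continuous_on_compose2[OF \<psi>_cont c_cont]) (use \<Gamma>\<phi> \<phi>S(2) in \<open>force intro: image_eqI[OF sym]\<close>)
  then show "continuous_on {-K..K} \<phi>"
    using \<phi>\<psi> by (subst continuous_on_cong[OF refl]) auto
  fix t assume t: "t \<in> {-K<..<K}"
  then have t': "t \<in> {-K..K}" by auto
  have im: "{\<Gamma> (-K-1)<..<\<Gamma> (K+1)} \<subseteq> \<Gamma> ` S"
  proof
    fix z assume "z \<in> {\<Gamma> (-K-1)<..<\<Gamma> (K+1)}"
    then show "z \<in> \<Gamma> ` S"
      using IVT'[of \<Gamma> "-K-1" z "K+1"] \<Gamma>_cont \<open>0 < K\<close> by (auto simp: S_def)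
  qed
  have ct: "c t \<in> {\<Gamma> (-K-1)<..<\<Gamma> (K+1)}"
  proof -
    have "\<Gamma> (-K-1) < \<Gamma> (\<phi> t)" "\<Gamma> (\<phi> t) < \<Gamma> (K+1)"
      using \<phi>S(1)[OF t'] \<phi>S(2)[OF t'] \<open>0 < K\<close> by (intro mono; force simp: S_def)+
    then show ?thesis using \<Gamma>\<phi>[OF t'] by simp
  qed
  have "(\<psi> has_real_derivative inverse (g (\<phi> t))) (at (c t))"
  proof (rule DERIV_inverse_function)
    show "(\<Gamma> has_real_derivative g (\<phi> t)) (at (\<psi> (c t)))"
      using \<Gamma>_deriv[OF \<phi>S(1)[OF t']] \<phi>\<psi>[OF t'] by simp
    show "g (\<phi> t) \<noteq> 0" using g(2)[of "\<phi> t"] by simp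
    show "\<Gamma> (-K-1) < c t" "c t < \<Gamma> (K+1)" using ct by auto
    show "\<Gamma> (\<psi> y) = y" if "\<Gamma> (-K-1) < y" "y < \<Gamma> (K+1)" for y
      unfolding \<psi>_def using im that inj by (intro f_the_inv_into_f) auto
    show "isCont \<psi> (c t)"
      using continuous_on_subset[OF \<psi>_cont im] ct
      by (simp add: continuous_on_eq_continuous_at)
  qed
  moreover have "(c has_real_derivative C / U * u t) (at t)"
  proof -
    have "((\<lambda>t. integral {-K..t} u) has_real_derivative u t) (at t within {-K..K})"
      using t by (intro integral_has_real_derivative u) auto
    moreover have "at t within {-K..K} = at t"
      using t by (intro at_within_interior) auto
    ultimately have "((\<lambda>t. integral {-K..t} u) has_real_derivative u t) (at t)" by simp
    from DERIV_add[OF DERIV_const[of "\<Gamma> (-K)"] DERIV_cmult[OF this, of "C / U"]]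
    show ?thesis unfolding c_def[abs_def] by simp
  qed
  ultimately have "((\<lambda>t. \<psi> (c t)) has_real_derivative inverse (g (\<phi> t)) * (C / U * u t)) (at t)"
    by (rule DERIV_chain2)
  then have "((\<lambda>t. \<psi> (c t)) has_real_derivative C * u t / (U * g (\<phi> t))) (at t)"
    by (simp add: divide_inverse mult_ac)
  moreover have "eventually (\<lambda>t. t \<in> {-K<..<K}) (nhds t)"
    using t by (intro eventually_nhds_in_open) auto
  then have "eventually (\<lambda>t. \<psi> (c t) = \<phi> t) (nhds t)"
    by eventually_elim (simp add: \<phi>\<psi>)
  ultimately show "(\<phi> has_real_derivative C * u t / (U * g (\<phi> t))) (at t)"
    using DERIV_cong_ev[OF refl _ refl, of "\<lambda>t. \<psi> (c t)" \<phi> t] by simp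
qed

lemma line_integration_by_parts:
  fixes F D \<phi> d :: "real \<Rightarrow> real"
  assumes "0 < K" "continuous_on {-K..K} F" "continuous_on {-K..K} \<phi>" "F (-K) = 0" "F K = 0"
    and "\<And>t. t \<in> {-K<..<K} \<Longrightarrow> (F has_real_derivative D t) (at t)"
    and "\<And>t. t \<in> {-K<..<K} \<Longrightarrow> (\<phi> has_real_derivative d t) (at t)"
  shows "((\<lambda>t. D t * \<phi> t + F t * d t) has_integral 0) {-K..K}"
proof -
  have "((\<lambda>t. D t * \<phi> t + F t * d t) has_integral F K * \<phi> K - F (-K) * \<phi> (-K)) {-K..K}"
    using assms
    by (intro fundamental_theorem_of_calculus_interior continuous_intros)
       (auto simp flip: has_real_derivative_iff_has_vector_derivative intro!: derivative_eq_intros)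
  with assms show ?thesis by simp
qed

section \<open>Integration by parts on the cube\<close>

text \<open>
  A source density: nonnegative, \<open>C\<^sup>1\<close> with bounded partial derivatives \<open>D i\<close>, and zero on the
  boundary of the cube and outside of it, so that integration by parts has no boundary terms.
\<close>

locale cube_density =
  fixes K :: real and F :: "('n::finite \<Rightarrow> real) \<Rightarrow> real" and D :: "'n \<Rightarrow> ('n \<Rightarrow> real) \<Rightarrow> real" and B :: real
  assumes K_pos: "0 < K"
    and cont_F: "continuous_on UNIV F"
    and F_nonneg: "0 \<le> F x"
    and F_bound: "\<bar>F x\<bar> \<le> B"
    and F_vanish: "K \<le> \<bar>x i\<bar> \<Longrightarrow> F x = 0"
    and deriv_F: "((\<lambda>t. F (x(i := t))) has_real_derivative D i x) (at (x i))"
    and cont_D: "continuous_on UNIV (D i)"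
    and D_bound: "\<bar>D i x\<bar> \<le> B"
begin

abbreviation P :: "('n \<Rightarrow> real) measure" where
  "P \<equiv> PiM UNIV (\<lambda>_. seg K)"

lemma deriv_fiber: "((\<lambda>t. F (x(i := t))) has_real_derivative D i (x(i := t))) (at t)"
  using deriv_F[of "x(i := t)" i] by simp

lemma fiber_measurable:
  fixes h :: "('n \<Rightarrow> real) \<Rightarrow> real"
  assumes "h \<in> borel_measurable borel"
  shows "(\<lambda>t. h (x(a := t))) \<in> borel_measurable borel"
  by (rule measurable_compose[OF borel_measurable_continuous_onI assms])
     (intro continuous_on_fun_upd_compose continuous_intros)

text \<open>
  The map \<open>\<tau>\<close> is only measurable, and differentiable along lines in direction \<open>a\<close> that meet the
  support of \<open>F\<close>; hence the argument goes line by line and uses Fubini. Its derivative \<open>d\<close> may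
  be unbounded. As \<open>d \<ge> 0\<close>, Tonelli gives the integrability of \<open>F * d\<close>: on each line the
  integral equals one of \<open>D a * \<tau>\<close>, which is bounded.
\<close>

lemma fiber_integration_by_parts:
  assumes m [measurable]: "\<tau> \<in> borel_measurable borel" "d \<in> borel_measurable borel"
    and \<tau>_bound: "\<And>x. (\<And>i. \<bar>x i\<bar> \<le> K) \<Longrightarrow> \<bar>\<tau> x\<bar> \<le> K" and d_nonneg: "\<And>x. 0 \<le> d x"
    and line: "\<And>x t. F (x(a := t)) \<noteq> 0 \<Longrightarrow>
      continuous_on {-K..K} (\<lambda>t. \<tau> (x(a := t))) \<and> continuous_on {-K..K} (\<lambda>t. d (x(a := t))) \<and>
      (\<forall>t\<in>{-K<..<K}. ((\<lambda>t. \<tau> (x(a := t))) has_real_derivative d (x(a := t))) (at t))"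
  shows "integrable P (\<lambda>x. F x * d x)" "integrable P (\<lambda>x. D a x * \<tau> x)"
    and "(\<integral>x. F x * d x \<partial>P) = - (\<integral>x. D a x * \<tau> x \<partial>P)"
proof -
  let ?Q = "PiM (UNIV - {a}) (\<lambda>_. seg K)"
  interpret P: finite_measure P by (rule finite_measure_PiM_seg)
  interpret Q: finite_measure ?Q by (rule finite_measure_PiM_seg)
  have B: "0 \<le> B" using F_bound abs_ge_zero order_trans by blast
  have [measurable]: "F \<in> borel_measurable borel" "D a \<in> borel_measurable borel"
    by (intro borel_measurable_continuous_onI cont_F cont_D)+
  have m1: "(\<lambda>x. F x * d x) \<in> borel_measurable borel" "(\<lambda>x. D a x * \<tau> x) \<in> borel_measurable borel"
    by measurable
  have mP: "(\<lambda>x. F x * d x) \<in> borel_measurable P" "(\<lambda>x. D a x * \<tau> x) \<in> borel_measurable P"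
    using m1 borel_measurable_cube by blast+
  have ins: "insert a (UNIV - {a}) = UNIV" by auto
  have D\<tau>: "integrable P (\<lambda>x. D a x * \<tau> x)"
  proof (rule P.integrable_const_bound[OF _ mP(2)])
    show "AE x in P. norm (D a x * \<tau> x) \<le> B * K"
      using AE_PiM_seg[of UNIV]
    proof eventually_elim
      case (elim x)
      then show ?case
        unfolding real_norm_def abs_mult using \<tau>_bound[of x] D_bound B by (intro mult_mono) auto
    qed
  qed
  then show "integrable P (\<lambda>x. D a x * \<tau> x)" .
  have fiber: "integrable (seg K) (\<lambda>t. F (x(a := t)) * d (x(a := t)))"
    "(\<integral>t. F (x(a := t)) * d (x(a := t)) \<partial>seg K) = - (\<integral>t. D a (x(a := t)) * \<tau> (x(a := t)) \<partial>seg K)" for x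
  proof -
    let ?Fd = "\<lambda>t. F (x(a := t)) * d (x(a := t))" and ?D\<tau> = "\<lambda>t. D a (x(a := t)) * \<tau> (x(a := t))"
    have "integrable (seg K) ?Fd \<and> (\<integral>t. ?Fd t \<partial>seg K) = - (\<integral>t. ?D\<tau> t \<partial>seg K)"
    proof (cases "\<exists>t. F (x(a := t)) \<noteq> 0")
      case False
      then have "((\<lambda>t. 0) has_real_derivative D a (x(a := t))) (at t)" for t
        using deriv_fiber[of x a t] by simp
      then have "D a (x(a := t)) = 0" for t
        using DERIV_const DERIV_unique by blast
      with False show ?thesis by simp
    next
      case True
      then have l: "continuous_on {-K..K} (\<lambda>t. \<tau> (x(a := t)))" "continuous_on {-K..K} (\<lambda>t. d (x(a := t)))"
        "\<And>t. t\<in>{-K<..<K} \<Longrightarrow> ((\<lambda>t. \<tau> (x(a := t))) has_real_derivative d (x(a := t))) (at t)"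
        using line by blast+
      have c1: "continuous_on {-K..K} ?Fd" and c2: "continuous_on {-K..K} ?D\<tau>"
        by (intro continuous_intros continuous_fiber cont_F cont_D l)+
      have "((\<lambda>t. ?D\<tau> t + ?Fd t) has_integral 0) {-K..K}"
        using K_pos by (intro line_integration_by_parts l deriv_fiber continuous_fiber cont_F)
          (auto intro: F_vanish[of _ a])
      then have "integral {-K..K} ?D\<tau> + integral {-K..K} ?Fd = 0"
        using integral_add[OF integrable_continuous_real[OF c2] integrable_continuous_real[OF c1]]
        by (simp add: integral_unique)
      then show ?thesis
        using integral_seg[OF c1 fiber_measurable[OF m1(1)]] integral_seg[OF c2 fiber_measurable[OF m1(2)]]
        by simp
    qed
    then show "integrable (seg K) ?Fd" "(\<integral>t. ?Fd t \<partial>seg K) = - (\<integral>t. ?D\<tau> t \<partial>seg K)" by auto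
  qed
  have ub: "\<bar>\<integral>t. D a (x(a := t)) * \<tau> (x(a := t)) \<partial>seg K\<bar> \<le> B * K * measure (seg K) UNIV"
    if "\<forall>i\<in>UNIV-{a}. \<bar>x i\<bar> \<le> K" for x
  proof -
    have b: "AE t in seg K. norm (D a (x(a := t)) * \<tau> (x(a := t))) \<le> B * K"
      using AE_seg[of K]
    proof eventually_elim
      case (elim t)
      then show ?case
        unfolding real_norm_def abs_mult using \<tau>_bound[of "x(a:=t)"] D_bound B that by (intro mult_mono) auto
    qed
    have i: "integrable (seg K) (\<lambda>t. D a (x(a := t)) * \<tau> (x(a := t)))"
      using fiber_measurable[OF m1(2), of x a] by (intro seg.integrable_const_bound[OF b]) simp
    have "norm (\<integral>t. D a (x(a := t)) * \<tau> (x(a := t)) \<partial>seg K) \<le> (\<integral>t. norm (D a (x(a := t)) * \<tau> (x(a := t))) \<partial>seg K)"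
      by (rule integral_norm_bound)
    also have "\<dots> \<le> (\<integral>t. B * K \<partial>seg K)"
      using b i by (intro integral_mono_AE integrable_norm) auto
    finally show ?thesis by (simp add: mult_ac)
  qed
  show Fd: "integrable P (\<lambda>x. F x * d x)"
  proof (rule integrableI_bounded[OF mP(1)])
    have "(\<integral>\<^sup>+x. ennreal (norm (F x * d x)) \<partial>P)
       = (\<integral>\<^sup>+x. (\<integral>\<^sup>+t. ennreal (F (x(a := t)) * d (x(a := t))) \<partial>seg K) \<partial>?Q)"
      using segs.product_nn_integral_insert[of "UNIV - {a}" a "\<lambda>x. ennreal (norm (F x * d x))" K] mP(1)
      by (simp add: ins F_nonneg d_nonneg abs_mult)
    also have "\<dots> = (\<integral>\<^sup>+x. ennreal (\<integral>t. F (x(a := t)) * d (x(a := t)) \<partial>seg K) \<partial>?Q)"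
      by (intro nn_integral_cong nn_integral_eq_integral fiber) (simp add: F_nonneg d_nonneg)
    also have "\<dots> \<le> (\<integral>\<^sup>+x. ennreal (B * K * measure (seg K) UNIV) \<partial>?Q)"
      using AE_PiM_seg[of "UNIV - {a}"]
    proof (intro nn_integral_mono_AE, eventually_elim)
      case (elim x)
      then show ?case unfolding fiber(2) using ub[of x] by (intro ennreal_leI) linarith
    qed
    also have "\<dots> < \<infinity>"
      by (simp add: ennreal_mult_eq_top_iff less_top[symmetric] Q.emeasure_finite[unfolded infinity_ennreal_def])
    finally show "(\<integral>\<^sup>+x. ennreal (norm (F x * d x)) \<partial>P) < \<infinity>" .
  qed
  show "(\<integral>x. F x * d x \<partial>P) = - (\<integral>x. D a x * \<tau> x \<partial>P)"
    using segs.product_integral_insert[of "UNIV - {a}" a K "\<lambda>x. F x * d x"] Fd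
      segs.product_integral_insert[of "UNIV - {a}" a K "\<lambda>x. D a x * \<tau> x"] D\<tau>
    by (simp add: ins fiber(2))
qed

end

section \<open>The Knothe map\<close>

lemma integral_seg_atMost:
  fixes h :: "real \<Rightarrow> real"
  assumes h: "continuous_on UNIV h" and c: "c \<in> {-K..K}"
  shows "(\<integral>t. (if t \<le> c then h t else 0) \<partial>seg K) = integral {-K..c} h"
proof -
  have [measurable]: "h \<in> borel_measurable borel" by (intro borel_measurable_continuous_onI h)
  have "(\<integral>t. (if t \<le> c then h t else 0) \<partial>seg K) = (\<integral>t. indicator {-K..K} t *\<^sub>R (if t \<le> c then h t else 0) \<partial>lborel)"
    unfolding seg_eq_real_density by (rule integral_density) auto
  also have "\<dots> = (LINT t:{-K..c}|lborel. h t)"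
    using c by (auto simp: set_lebesgue_integral_def indicator_def intro!: Bochner_Integration.integral_cong)
  also have "\<dots> = integral {-K..c} h"
    by (intro set_borel_integral_eq_integral borel_integrable_atLeastAtMost' continuous_on_subset[OF h]) auto
  finally show ?thesis .
qed

lemma measurable_partial_marg:
  fixes u :: "('n::finite \<Rightarrow> real) \<Rightarrow> real"
  assumes [measurable]: "u \<in> borel_measurable borel" "c \<in> borel_measurable borel"
  shows "(\<lambda>x. \<integral>t. (if t \<le> c x then u (x(a := t)) else 0) \<partial>seg K) \<in> borel_measurable borel"
proof (rule seg.borel_measurable_lebesgue_integral)
  have [measurable]: "(\<lambda>p. (fst p)(a := snd p)) \<in> measurable (borel \<Otimes>\<^sub>M seg K) (borel :: ('n \<Rightarrow> real) measure)"
  proof (rule measurable_coords)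
    show "(\<lambda>p. ((fst p)(a := snd p)) i) \<in> borel_measurable ((borel :: ('n \<Rightarrow> real) measure) \<Otimes>\<^sub>M seg K)" for i
      by (cases "i = a") simp_all
  qed
  show "(\<lambda>(x, t). if t \<le> c x then u (x(a := t)) else 0) \<in> borel_measurable (borel \<Otimes>\<^sub>M seg K)"
    unfolding case_prod_beta by measurable
qed

context cube_density
begin

text \<open>
  The coordinates in \<open>A\<close> of the Knothe map that sends the normalised density \<open>F\<close> to the
  normalised density \<open>G\<close> on the cube; \<open>d i\<close> is the partial derivative of the coordinate \<open>T i\<close> in
  direction \<open>i\<close>. The last clause is the Monge-Ampere equation for the marginals on the
  coordinates in \<open>A\<close>, whose Jacobian is a product because the map is triangular. This equation
  and the integration by parts formula are the two facts that the entropy estimate combines.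
\<close>

definition knothe_map :: "(('n \<Rightarrow> real) \<Rightarrow> real) \<Rightarrow> 'n set \<Rightarrow> (('n \<Rightarrow> real) \<Rightarrow> 'n \<Rightarrow> real)
    \<Rightarrow> ('n \<Rightarrow> ('n \<Rightarrow> real) \<Rightarrow> real) \<Rightarrow> bool" where
  "knothe_map G A T d \<longleftrightarrow>
    (\<forall>i. (\<lambda>x. T x i) \<in> borel_measurable borel) \<and> (\<forall>x i. \<bar>T x i\<bar> \<le> K) \<and>
    (\<forall>x y. (\<forall>i\<in>A. x i = y i) \<longrightarrow> T x = T y) \<and>
    (\<forall>i\<in>A. integrable P (\<lambda>x. F x * d i x) \<and> integrable P (\<lambda>x. D i x * T x i) \<and>
       (\<integral>x. F x * d i x \<partial>P) = - (\<integral>x. D i x * T x i \<partial>P)) \<and>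
    (\<forall>x. 0 < F x \<longrightarrow> (\<forall>i\<in>A. 0 < d i x) \<and>
       marg K (-A) F x * (\<integral>y. G y \<partial>P) = (\<integral>y. F y \<partial>P) * marg K (-A) G (T x) * (\<Prod>i\<in>A. d i x))"

lemma knothe_mapD:
  assumes "knothe_map G A T d"
  shows "(\<lambda>x. T x i) \<in> borel_measurable borel" "\<bar>T x i\<bar> \<le> K"
    and "(\<And>i. i \<in> A \<Longrightarrow> x i = y i) \<Longrightarrow> T x = T y"
    and "i \<in> A \<Longrightarrow> integrable P (\<lambda>x. F x * d i x)" "i \<in> A \<Longrightarrow> integrable P (\<lambda>x. D i x * T x i)"
    and "i \<in> A \<Longrightarrow> (\<integral>x. F x * d i x \<partial>P) = - (\<integral>x. D i x * T x i \<partial>P)"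
    and "0 < F x \<Longrightarrow> i \<in> A \<Longrightarrow> 0 < d i x"
    and "0 < F x \<Longrightarrow>
       marg K (-A) F x * (\<integral>y. G y \<partial>P) = (\<integral>y. F y \<partial>P) * marg K (-A) G (T x) * (\<Prod>i\<in>A. d i x)"
  using assms unfolding knothe_map_def by simp_all

text \<open>
  Coordinates are added one at a time. Given the map on \<open>A\<close>, the new coordinate \<open>a\<close> is moved by
  the increasing rearrangement of the conditional density of \<open>F\<close>, given the coordinates in \<open>A\<close>
  of \<open>x\<close>, onto the conditional density of \<open>G\<close>, given the coordinates in \<open>A\<close> of \<open>T x\<close>. Both
  conditional densities are quotients of consecutive marginals, so the product of the
  one-dimensional Monge-Ampere equations telescopes to the equation for \<open>insert a A\<close>.
\<close>

lemma knothe_map_exists: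
  assumes G: "continuous_on UNIV G" "\<And>y. 0 < G y" "\<And>y. \<bar>G y\<bar> \<le> B'"
  shows "\<exists>T d. knothe_map G A T d"
  using finite[of A]
proof (induction A)
  case empty
  have "knothe_map G {} (\<lambda>_ _. 0) (\<lambda>_ _. 0)"
    using K_pos by (simp add: knothe_map_def marg_UNIV)
  then show ?case by blast
next
  case (insert a A)
  then obtain T d where Td: "knothe_map G A T d"
    by blast
  note T_meas = knothe_mapD(1)[OF Td] and T_bound = knothe_mapD(2)[OF Td] and T_cong = knothe_mapD(3)[OF Td]
    and d_int = knothe_mapD(4,5,6)[OF Td] and d_pos = knothe_mapD(7)[OF Td] and jac = knothe_mapD(8)[OF Td]
  define J where "J = - insert a A"
  have J: "- A = insert a J" "a \<notin> J" using insert.hyps by (auto simp: J_def)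
  \<comment> \<open>The conditional densities in the variable \<open>a\<close> are \<open>u / U\<close> at \<open>x\<close> and \<open>g / W\<close> at \<open>T x\<close>; \<open>\<Phi>\<close> and
     \<open>\<Gamma>\<close> are the distribution functions without these normalisations.\<close>
  define u where "u = marg K J F"
  define g where "g = marg K J G"
  define U where "U = marg K (insert a J) F"
  define W where "W x = marg K (insert a J) G (T x)" for x
  define \<Phi> where "\<Phi> x = (\<integral>t. (if t \<le> x a then u (x(a := t)) else 0) \<partial>seg K)" for x
  define \<Gamma> where "\<Gamma> x c = (\<integral>t. (if t \<le> c then g ((T x)(a := t)) else 0) \<partial>seg K)" for x c
  \<comment> \<open>Where \<open>U\<close> vanishes there is no mass to move, and any value in the segment serves.\<close>
  define \<tau> where "\<tau> x = (if 0 < U x then SOME y. y \<in> {-K..K} \<and> U x * \<Gamma> x y = W x * \<Phi> x else 0)" for x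
  define da where "da x = W x * u x / (U x * g ((T x)(a := \<tau> x)))" for x
  have u_cont: "continuous_on UNIV u" and g_cont: "continuous_on UNIV g" and U_cont: "continuous_on UNIV U"
    unfolding u_def g_def U_def by (intro continuous_on_marg[OF cont_F F_bound] continuous_on_marg[OF G(1,3)])+
  have u_nonneg: "0 \<le> u x" and U_nonneg: "0 \<le> U x" for x
    unfolding u_def U_def by (intro marg_nonneg F_nonneg)+
  have g_pos: "0 < g x" for x
  proof -
    have "0 < marg K J G (\<lambda>j. if j \<in> J then 0 else x j)" unfolding g_def
      using K_pos G(2) by (intro marg_pos[OF G(1,3)]) (auto intro: less_imp_le)
    also have "\<dots> = g x" unfolding g_def by (intro marg_cong) auto
    finally show ?thesis .
  qed
  have fib_u: "continuous_on S (\<lambda>t. u (x(a := t)))" and fib_g: "continuous_on S (\<lambda>t. g (x(a := t)))" for S x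
    by (intro continuous_fiber u_cont g_cont)+
  have U_eq: "U x = integral {-K..K} (\<lambda>t. u (x(a := t)))" for x
    unfolding U_def marg_insert[OF cont_F F_bound J(2)] u_def[symmetric]
    by (intro integral_seg borel_measurable_continuous_onI fib_u)
  have W_eq: "W x = integral {-K..K} (\<lambda>t. g ((T x)(a := t)))" for x
    unfolding W_def marg_insert[OF G(1,3) J(2)] g_def[symmetric]
    by (intro integral_seg borel_measurable_continuous_onI fib_g)
  have \<Gamma>_eq: "\<Gamma> x c = integral {-K..c} (\<lambda>t. g ((T x)(a := t)))" if "c \<in> {-K..K}" for x c
    unfolding \<Gamma>_def using that by (intro integral_seg_atMost fib_g)
  have \<Phi>_eq: "\<Phi> x = integral {-K..x a} (\<lambda>t. u (x(a := t)))" if "x a \<in> {-K..K}" for x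
    unfolding \<Phi>_def using that by (intro integral_seg_atMost fib_u)
  have u_meas [measurable]: "u \<in> borel_measurable borel" and g_meas [measurable]: "g \<in> borel_measurable borel"
    and U_meas [measurable]: "U \<in> borel_measurable borel"
    by (intro borel_measurable_continuous_onI u_cont g_cont U_cont)+
  have T_meas' [measurable]: "T \<in> measurable borel borel"
    by (intro measurable_coords T_meas)
  have W_meas [measurable]: "W \<in> borel_measurable borel"
    unfolding W_def
    by (intro measurable_compose[OF T_meas'] borel_measurable_continuous_onI continuous_on_marg[OF G(1,3)])
  have \<Phi>_meas [measurable]: "\<Phi> \<in> borel_measurable borel"
    unfolding \<Phi>_def by (intro measurable_partial_marg) auto
  have \<Gamma>_meas [measurable]: "(\<lambda>x. \<Gamma> x c) \<in> borel_measurable borel" for c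
    unfolding \<Gamma>_def by (rule measurable_compose[OF T_meas' measurable_partial_marg]) auto
  have \<Phi>_bounds: "0 \<le> \<Phi> x" "\<Phi> x \<le> U x" for x
  proof -
    show "0 \<le> \<Phi> x" unfolding \<Phi>_def by (intro integral_nonneg_AE AE_I2) (simp add: u_nonneg)
    have "integrable (seg K) (\<lambda>t. u (x(a := t)))"
      by (intro integral_seg borel_measurable_continuous_onI fib_u)
    then have "\<Phi> x \<le> (\<integral>t. u (x(a := t)) \<partial>seg K)"
      unfolding \<Phi>_def by (intro integral_mono') (auto simp: u_nonneg)
    then show "\<Phi> x \<le> U x"
      unfolding U_def marg_insert[OF cont_F F_bound J(2)] u_def .
  qed
  have W_pos: "0 < W x" for x
    unfolding W_eq using antiderivative_strict_mono[where g = "\<lambda>t. g ((T x)(a := t))" and a = "-K" and b = K and s = "-K" and t = K, OF fib_g g_pos] K_pos by simp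
  have \<tau>: "\<tau> x \<in> {-K..K}" "U x * \<Gamma> x (\<tau> x) = W x * \<Phi> x" if "0 < U x" for x
  proof -
    have "0 \<le> W x * \<Phi> x / U x" "W x * \<Phi> x / U x \<le> W x"
      using that \<Phi>_bounds[of x] W_pos[of x] by (auto simp: field_simps)
    then obtain y where "y \<in> {-K..K}" "integral {-K..y} (\<lambda>t. g ((T x)(a := t))) = W x * \<Phi> x / U x"
      using inverse_cdf_exists[where g = "\<lambda>t. g ((T x)(a := t))" and a = "-K" and b = K and c = "W x * \<Phi> x / U x", OF fib_g] K_pos by (auto simp: W_eq)
    then have "\<exists>y. y \<in> {-K..K} \<and> U x * \<Gamma> x y = W x * \<Phi> x"
      using that by (auto simp: \<Gamma>_eq intro!: exI[of _ y])
    from someI_ex[OF this] that show "\<tau> x \<in> {-K..K}" "U x * \<Gamma> x (\<tau> x) = W x * \<Phi> x"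
      by (auto simp: \<tau>_def)
  qed
  have \<tau>_bound: "\<bar>\<tau> x\<bar> \<le> K" for x
    using \<tau>(1)[of x] K_pos by (cases "0 < U x") (auto simp: abs_le_iff \<tau>_def)
  have \<Gamma>_mono: "\<Gamma> x y < \<Gamma> x z" if "-K \<le> y" "y < z" "z \<le> K" for x y z
    using antiderivative_strict_mono[where g = "\<lambda>t. g ((T x)(a := t))" and a = "-K" and b = K and s = y and t = z, OF fib_g g_pos] that
    by (simp add: \<Gamma>_eq)
  \<comment> \<open>Comparing distribution functions turns \<open>\<tau> x \<le> c\<close> into an inequality between measurable functions.\<close>
  have \<tau>_meas [measurable]: "\<tau> \<in> borel_measurable borel"
  proof (subst borel_measurable_iff_le, intro allI)
    fix c
    consider "c < -K" | "K < c" | "c \<in> {-K..K}" by fastforce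
    then show "{x \<in> space borel. \<tau> x \<le> c} \<in> sets borel"
    proof cases
      case 1
      then have "{x \<in> space borel. \<tau> x \<le> c} = {}" 
        using \<tau>_bound by (auto simp: abs_le_iff) (smt (verit, best))
      then show ?thesis by (metis sets.empty_sets)
    next
      case 2
      then have "{x \<in> space borel. \<tau> x \<le> c} = UNIV"
        using \<tau>_bound by (auto simp: abs_le_iff) (smt (verit, best))
      then show ?thesis by auto
    next
      case 3
      have pos: "\<tau> x \<le> c \<longleftrightarrow> W x * \<Phi> x \<le> U x * \<Gamma> x c" if "0 < U x" for x
      proof -
        have "\<tau> x \<le> c \<longleftrightarrow> \<Gamma> x (\<tau> x) \<le> \<Gamma> x c"
          using \<Gamma>_mono[of "\<tau> x" c x] \<Gamma>_mono[of c "\<tau> x" x] \<tau>(1)[OF that] 3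
          by (cases "\<tau> x" c rule: linorder_cases) auto
        also have "\<dots> \<longleftrightarrow> U x * \<Gamma> x (\<tau> x) \<le> U x * \<Gamma> x c"
          using that by simp
        finally show ?thesis using \<tau>(2)[OF that] by simp
      qed
      have "\<tau> x \<le> c \<longleftrightarrow> 0 < U x \<and> W x * \<Phi> x \<le> U x * \<Gamma> x c \<or> 0 \<le> c \<and> U x \<le> 0" for x
        using pos[of x] by (cases "0 < U x") (auto simp: \<tau>_def)
      then have "{x \<in> space borel. \<tau> x \<le> c} =
          {x \<in> space borel. 0 < U x} \<inter> {x \<in> space borel. W x * \<Phi> x \<le> U x * \<Gamma> x c} \<union>
          (if 0 \<le> c then {x \<in> space borel. U x \<le> 0} else {})"
        by auto
      also have "\<dots> \<in> sets borel"
        by (intro sets.Un sets.Int borel_measurable_less borel_measurable_le) 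
          (auto intro!: borel_measurable_le borel_measurable_times U_meas W_meas \<Phi>_meas \<Gamma>_meas)
      finally show ?thesis .
    qed
  qed
  have T'_meas: "(\<lambda>x. ((T x)(a := \<tau> x)) i) \<in> borel_measurable borel" for i
    using T_meas \<tau>_meas by (cases "i = a") auto
  then have [measurable]: "(\<lambda>x. (T x)(a := \<tau> x)) \<in> measurable borel borel"
    by (intro measurable_coords)
  have da_meas [measurable]: "da \<in> borel_measurable borel"
    unfolding da_def by measurable
  have da_nonneg: "0 \<le> da x" for x
    unfolding da_def using W_pos[of x] u_nonneg U_nonneg g_pos[of "(T x)(a := \<tau> x)"]
    by (intro divide_nonneg_nonneg mult_nonneg_nonneg) (auto intro: less_imp_le)
  have F_pos: "0 < u x" "0 < U x" if "0 < F x" for x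
  proof -
    have "\<bar>x i\<bar> \<le> K" for i using F_vanish[of x i] that by linarith
    then show "0 < u x" "0 < U x"
      unfolding u_def U_def using that K_pos F_nonneg by (intro marg_pos[OF cont_F F_bound]; simp)+
  qed
  have line: "continuous_on {-K..K} (\<lambda>t. \<tau> (x(a := t))) \<and> continuous_on {-K..K} (\<lambda>t. da (x(a := t))) \<and>
      (\<forall>t\<in>{-K<..<K}. ((\<lambda>t. \<tau> (x(a := t))) has_real_derivative da (x(a := t))) (at t))"
    if "F (x(a := t0)) \<noteq> 0" for x t0
  proof -
    have T_const: "T (x(a := t)) = T x" for t
      by (rule T_cong) (use insert.hyps(2) in auto)
    have const: "U (x(a := t)) = U x" "T (x(a := t)) = T x" "W (x(a := t)) = W x" for t
      unfolding U_def W_def T_const by (rule marg_cong; simp) (rule refl)+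
    have Ux: "0 < U x"
      using F_pos(2)[of "x(a := t0)"] that F_nonneg[of "x(a := t0)"] const by simp
    have eq: "U x * integral {-K..\<tau> (x(a := t))} (\<lambda>t. g ((T x)(a := t))) = W x * integral {-K..t} (\<lambda>t. u (x(a := t)))"
      and in_seg: "\<tau> (x(a := t)) \<in> {-K..K}" if "t \<in> {-K..K}" for t
      using \<tau>[of "x(a := t)"] Ux that by (auto simp: const \<Gamma>_eq \<Phi>_eq)
    note inv = has_derivative_inverse_cdf[OF K_pos fib_g g_pos fib_u Ux in_seg eq]
    have "continuous_on {-K..K} (\<lambda>t. da (x(a := t)))"
      unfolding da_def const
      using Ux g_pos by (intro continuous_intros fib_u continuous_on_compose2[OF g_cont] 
          continuous_on_fun_upd_compose inv(1)) (auto simp: less_imp_neq[symmetric])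
    moreover have "((\<lambda>t. \<tau> (x(a := t))) has_real_derivative da (x(a := t))) (at t)" if "t \<in> {-K<..<K}" for t
      using inv(2)[OF _ _ that] by (simp add: da_def const)
    ultimately show ?thesis using inv(1) by blast
  qed
  note parts = fiber_integration_by_parts[OF \<tau>_meas da_meas \<tau>_bound da_nonneg line]
  have "knothe_map G (insert a A) (\<lambda>x. (T x)(a := \<tau> x)) (d(a := da))"
    unfolding knothe_map_def
  proof (intro conjI allI impI ballI)
    fix i show "(\<lambda>x. ((T x)(a := \<tau> x)) i) \<in> borel_measurable borel" by (rule T'_meas)
  next
    fix x i show "\<bar>((T x)(a := \<tau> x)) i\<bar> \<le> K" using T_bound \<tau>_bound by simp
  next
    fix x y :: "'n \<Rightarrow> real" assume xy: "\<forall>i\<in>insert a A. x i = y i"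
    then have T: "T x = T y" by (intro T_cong) auto
    have 1: "U x = U y" unfolding U_def using xy J by (intro marg_cong) auto
    have 2: "u (x(a := t)) = u (y(a := t))" for t
      unfolding u_def using xy J_def by (intro marg_cong) auto
    have "x a = y a" using xy by blast
    then have "\<Phi> x = \<Phi> y" "W x = W y" "\<Gamma> x c = \<Gamma> y c" for c
      by (simp_all only: \<Phi>_def W_def \<Gamma>_def 2 T)
    then have "\<tau> x = \<tau> y" by (simp only: \<tau>_def 1)
    then show "(T x)(a := \<tau> x) = (T y)(a := \<tau> y)" using T by simp
  next
    fix i assume "i \<in> insert a A"
    then show "integrable P (\<lambda>x. F x * (d(a := da)) i x)" 
      "integrable P (\<lambda>x. D i x * ((T x)(a := \<tau> x)) i)" 
      "(\<integral>x. F x * (d(a := da)) i x \<partial>P) = - (\<integral>x. D i x * ((T x)(a := \<tau> x)) i \<partial>P)"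
      using parts d_int by (cases "i = a"; auto)+
  next
    fix x i assume "0 < F x" "i \<in> insert a A"
    then show "0 < (d(a := da)) i x"
      using d_pos F_pos[of x] W_pos g_pos by (auto simp: da_def)
  next
    fix x assume x: "0 < F x"
    have prod: "(\<Prod>i\<in>insert a A. (d(a := da)) i x) = da x * (\<Prod>i\<in>A. d i x)"
      using insert.hyps by (auto intro!: prod.cong simp: prod.insert)
    have da: "da x * U x * g ((T x)(a := \<tau> x)) = W x * u x"
      using F_pos(2)[OF x] g_pos[of "(T x)(a := \<tau> x)"] by (simp add: da_def)
    have "U x * (u x * (\<integral>y. G y \<partial>P)) = u x * ((\<integral>y. F y \<partial>P) * W x * (\<Prod>i\<in>A. d i x))"
      using jac[OF x] by (simp add: U_def W_def J(1))
    also have "\<dots> = (W x * u x) * ((\<integral>y. F y \<partial>P) * (\<Prod>i\<in>A. d i x))" by simp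
    also have "\<dots> = U x * ((\<integral>y. F y \<partial>P) * g ((T x)(a := \<tau> x)) * (da x * (\<Prod>i\<in>A. d i x)))"
      unfolding da[symmetric] by simp
    finally show "marg K (- insert a A) F x * (\<integral>y. G y \<partial>P) =
      (\<integral>y. F y \<partial>P) * marg K (- insert a A) G ((T x)(a := \<tau> x)) * (\<Prod>i\<in>insert a A. (d(a := da)) i x)"
      using F_pos(2)[OF x] unfolding prod J_def[symmetric] u_def[symmetric] g_def[symmetric] by simp
  qed
  then show ?case by blast
qed

end

section \<open>From the function space to Euclidean space\<close>

interpretation lborels: product_sigma_finite "\<lambda>_. lborel :: real measure"
  by standard

lemma lborel_vec_eq_distr_PiM:
  "(lborel :: (real^'n) measure) = distr (PiM UNIV (\<lambda>_. lborel)) borel vec_lambda"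
proof (rule lborel_eqI)
  let ?M = "PiM UNIV (\<lambda>_::'n. lborel :: real measure)"
  have mv: "vec_lambda \<in> measurable ?M (borel :: (real^'n) measure)"
  proof (rule borel_measurableI)
    fix S :: "(real^'n) set" assume "open S"
    moreover have "continuous_on UNIV (vec_lambda :: ('n \<Rightarrow> real) \<Rightarrow> real^'n)"
      by (rule continuous_on_vec_lambda) simp
    ultimately have "open (vec_lambda -` S :: ('n \<Rightarrow> real) set)"
      by (simp add: continuous_on_open_vimage)
    then have "vec_lambda -` S \<in> sets (PiM UNIV (\<lambda>_::'n. borel :: real measure))"
      by (simp add: sets_PiM_equal_borel)
    moreover have "sets ?M = sets (PiM UNIV (\<lambda>_::'n. borel :: real measure))"
      by (intro sets_PiM_cong) auto
    ultimately show "vec_lambda -` S \<inter> space ?M \<in> sets ?M"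
      by (simp add: space_PiM)
  qed
  fix l u :: "real^'n" assume lu: "\<And>b. b \<in> Basis \<Longrightarrow> l \<bullet> b \<le> u \<bullet> b"
  have "l $ i \<le> u $ i" for i
    using lu[of "axis i 1"] by (simp add: axis_in_Basis_iff inner_axis)
  have "vec_lambda -` box l u \<inter> space ?M = Pi\<^sub>E UNIV (\<lambda>i. {l $ i<..<u $ i})"
    by (auto simp: mem_box_cart space_PiM PiE_def Pi_def)
  then have "emeasure (distr ?M borel vec_lambda) (box l u) = emeasure ?M (Pi\<^sub>E UNIV (\<lambda>i. {l $ i<..<u $ i}))"
    using mv by (subst emeasure_distr) auto
  also have "\<dots> = (\<Prod>i\<in>UNIV. ennreal (u $ i - l $ i))"
    using \<open>\<And>i. l $ i \<le> u $ i\<close> by (subst lborels.emeasure_PiM) auto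
  also have "\<dots> = ennreal (\<Prod>i\<in>UNIV. u $ i - l $ i)"
    using \<open>\<And>i. l $ i \<le> u $ i\<close> by (intro prod_ennreal) auto
  also have "(\<Prod>i\<in>UNIV. u $ i - l $ i) = (\<Prod>b\<in>Basis. (u - l) \<bullet> b)"
    by (simp add: Basis_vec_def UNION_singleton_eq_range prod.reindex axis_eq_axis inj_on_def inner_axis)
  finally show "emeasure (distr ?M borel vec_lambda) (box l u) = (\<Prod>b\<in>Basis. (u - l) \<bullet> b)" .
qed simp

lemma PiM_seg_eq_density:
  "PiM UNIV (\<lambda>_::'n::finite. seg K) = density (PiM UNIV (\<lambda>_. lborel)) (indicator (Pi\<^sub>E UNIV (\<lambda>_. {-K..K})))"
proof (rule segs.PiM_eqI[symmetric])
  let ?M = "PiM UNIV (\<lambda>_::'n. lborel :: real measure)"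
  let ?C = "Pi\<^sub>E UNIV (\<lambda>_::'n. {-K..K})"
  show "sets (density ?M (indicator ?C)) = sets (PiM UNIV (\<lambda>_::'n. seg K))"
    unfolding sets_density by (intro sets_PiM_cong) auto
  fix A :: "'n \<Rightarrow> real set" assume "\<And>i. i \<in> UNIV \<Longrightarrow> A i \<in> sets (seg K)"
  then have A: "A i \<in> sets borel" for i by auto
  have AM: "Pi\<^sub>E UNIV A \<in> sets ?M" "?C \<in> sets ?M"
    using A by (auto intro!: sets_PiM_I_finite)
  have "emeasure (density ?M (indicator ?C)) (Pi\<^sub>E UNIV A) = emeasure ?M (?C \<inter> Pi\<^sub>E UNIV A)"
    using AM by (subst emeasure_density) (auto simp flip: indicator_inter_arith)
  also have "?C \<inter> Pi\<^sub>E UNIV A = Pi\<^sub>E UNIV (\<lambda>i. A i \<inter> {-K..K})"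
    by (auto simp: PiE_def Pi_def)
  also have "emeasure ?M \<dots> = (\<Prod>i\<in>UNIV. emeasure lborel (A i \<inter> {-K..K}))"
    using A by (intro lborels.emeasure_PiM) auto
  finally show "emeasure (density ?M (indicator ?C)) (Pi\<^sub>E UNIV A) = (\<Prod>i\<in>UNIV. emeasure (seg K) (A i))"
    using A by (simp add: emeasure_seg)
qed simp

lemma measurable_vec_lambda:
  "vec_lambda \<in> measurable borel (borel :: (real^'n) measure)"
  by (intro borel_measurable_continuous_onI continuous_on_vec_lambda continuous_on_product_coordinates)

lemma integral_cube:
  fixes H :: "real^'n \<Rightarrow> real"
  assumes [measurable]: "H \<in> borel_measurable borel"
  shows "(\<integral>y. H (vec_lambda y) \<partial>PiM UNIV (\<lambda>_. seg K)) = (\<integral>x. indicator {x. \<forall>i. \<bar>x $ i\<bar> \<le> K} x * H x \<partial>lborel)"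
proof -
  let ?M = "PiM UNIV (\<lambda>_::'n. lborel :: real measure)"
  let ?C = "Pi\<^sub>E UNIV (\<lambda>_::'n. {-K..K})"
  have sets_M: "sets ?M = sets (borel :: ('n \<Rightarrow> real) measure)"
    unfolding sets_PiM_equal_borel[symmetric] by (intro sets_PiM_cong) auto
  have mv [measurable]: "vec_lambda \<in> measurable ?M (borel :: (real^'n) measure)"
    using measurable_vec_lambda measurable_cong_sets[OF sets_M refl] by blast
  have C: "?C \<in> sets ?M" by (auto intro!: sets_PiM_I_finite)
  have cube: "{x :: real^'n. \<forall>i. \<bar>x $ i\<bar> \<le> K} \<in> sets borel"
    by (intro borel_closed closed_Collect_all closed_Collect_le continuous_intros)
  have "PiM UNIV (\<lambda>_::'n. seg K) = density ?M (\<lambda>y. ennreal (indicat_real ?C y))"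
    unfolding PiM_seg_eq_density by (simp add: ennreal_indicator)
  then have "(\<integral>y. H (vec_lambda y) \<partial>PiM UNIV (\<lambda>_. seg K)) = (\<integral>y. indicator ?C y *\<^sub>R H (vec_lambda y) \<partial>?M)"
    using C by (simp only:) (rule integral_density, auto intro: measurable_compose[OF mv])
  also have "\<dots> = (\<integral>y. indicator {x. \<forall>i. \<bar>x $ i\<bar> \<le> K} (vec_lambda y) * H (vec_lambda y) \<partial>?M)"
    by (intro Bochner_Integration.integral_cong)
      (auto simp: indicator_def abs_le_iff PiE_def Pi_def, (metis minus_le_iff)+)
  also have "\<dots> = (\<integral>x. indicator {x. \<forall>i. \<bar>x $ i\<bar> \<le> K} x * H x \<partial>distr ?M borel vec_lambda)"
    using cube by (intro integral_distr[symmetric]) (auto intro: mv)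
  finally show ?thesis by (simp only: lborel_vec_eq_distr_PiM[symmetric])
qed

lemma integrable_cube:
  fixes H :: "real^'n \<Rightarrow> real"
  assumes H: "continuous_on UNIV H"
  shows "integrable (PiM UNIV (\<lambda>_. seg K)) (\<lambda>y. H (vec_lambda y))"
proof -
  interpret P: finite_measure "PiM UNIV (\<lambda>_::'n. seg K)" by (rule finite_measure_PiM_seg)
  let ?C = "cbox (\<chi> i. -K) (\<chi> i. K) :: (real^'n) set"
  have "bounded (H ` ?C)"
    by (intro compact_imp_bounded compact_continuous_image continuous_on_subset[OF H]) auto
  then obtain B where B: "\<And>x. x \<in> ?C \<Longrightarrow> norm (H x) \<le> B"
    by (auto simp: bounded_iff)
  show ?thesis
  proof (rule P.integrable_const_bound)
    show "AE y in PiM UNIV (\<lambda>_::'n. seg K). norm (H (vec_lambda y)) \<le> B"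
      using AE_PiM_seg[of UNIV K]
      by eventually_elim (rule B, auto simp: mem_box_cart abs_le_iff, (metis minus_le_iff)+)
    show "(\<lambda>y. H (vec_lambda y)) \<in> borel_measurable (PiM UNIV (\<lambda>_::'n. seg K))"
      using measurable_compose[OF measurable_vec_lambda borel_measurable_continuous_onI[OF H]] 
        borel_measurable_cube by blast
  qed
qed

section \<open>Gradients and strongly convex potentials\<close>

text \<open>
  For the nonnegative \<open>f\<close> of the theorem: where \<open>f\<close> vanishes, so does the vector field
  \<open>(1 - s) f \<nabla>V + 2 s \<nabla>f\<close>, and the integral of its squared norm over a cube
  containing the support of \<open>f\<close> is the integral over the whole space.
\<close>

lemma grad_minimum_zero:
  fixes f :: "real^'n \<Rightarrow> real"
  assumes "f differentiable at x" "\<And>y. 0 \<le> f y" "f x = 0"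
  shows "grad f x = 0"
proof -
  have "frechet_derivative f (at x) = (\<lambda>v. 0)"
    using assms by (intro differential_zero_maxmin[of x UNIV f]) (auto simp: frechet_derivative_works)
  then show ?thesis by (simp add: grad_def vec_eq_iff)
qed

lemma has_derivative_coordinate:
  fixes f :: "real^'n \<Rightarrow> real"
  assumes "f differentiable at (vec_lambda x)"
  shows "((\<lambda>t. f (vec_lambda (x(i := t)))) has_real_derivative grad f (vec_lambda x) $ i) (at (x i))"
proof -
  have eq: "vec_lambda (x(i := t)) = vec_lambda x + (t - x i) *\<^sub>R axis i 1" for t
    by (simp add: vec_eq_iff axis_def)
  have f: "(f has_derivative frechet_derivative f (at (vec_lambda x))) (at (vec_lambda (x(i := x i))))"
    using assms by (simp add: frechet_derivative_works)
  have "((\<lambda>t. vec_lambda (x(i := t))) has_derivative (\<lambda>t. t *\<^sub>R axis i 1)) (at (x i))"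
    unfolding eq by (auto intro!: derivative_eq_intros)
  from has_derivative_compose[OF this f]
  have "((\<lambda>t. f (vec_lambda (x(i := t)))) has_derivative 
    (\<lambda>t. frechet_derivative f (at (vec_lambda x)) (t *\<^sub>R axis i 1))) (at (x i))" .
  moreover have "frechet_derivative f (at (vec_lambda x)) (t *\<^sub>R axis i 1) = grad f (vec_lambda x) $ i * t" for t
    using linear_cmul[OF linear_frechet_derivative[OF assms], of t "axis i 1"] by (simp add: grad_def)
  ultimately show ?thesis
    by (simp add: has_field_derivative_def)
qed

lemma strong_convexity:
  fixes V :: "real^'n \<Rightarrow> real"
  assumes "C2 V" and hess: "\<And>x. loewner_le (R *\<^sub>R mat 1) (Hess V x)"
  shows "V x + grad V x \<bullet> (y - x) + R / 2 * (norm (y - x))\<^sup>2 \<le> V y"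
proof -
  define v where "v = y - x"
  have line: "((\<lambda>t. x + t *\<^sub>R v) has_derivative (\<lambda>t. t *\<^sub>R v)) (at t)" for t
    by (auto intro!: derivative_eq_intros)
  have V: "(V has_derivative (\<lambda>h. h \<bullet> grad V z)) (at z)" for z
    using assms(1) GDERIV_grad[of V z] by (simp add: C2_def C1_def gderiv_def)
  have V1: "((\<lambda>t. V (x + t *\<^sub>R v)) has_real_derivative grad V (x + t *\<^sub>R v) \<bullet> v) (at t)" for t
    using has_derivative_compose[OF line V, of t] by (simp add: has_field_derivative_def inner_commute mult_commute_abs)
  have gV: "(grad V has_derivative (\<lambda>h. Hess V z *v h)) (at z)" for z
  proof -
    have d: "grad V differentiable at z" using assms(1) by (simp add: C2_def)
    have "Hess V z *v h = frechet_derivative (grad V) (at z) h" for h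
      unfolding Hess_def matrix_vector_mul(2)[OF linear_frechet_derivative[OF d]] ..
    with d show ?thesis by (simp add: frechet_derivative_works)
  qed
  have V2: "((\<lambda>t. grad V (x + t *\<^sub>R v) \<bullet> v) has_real_derivative v \<bullet> (Hess V (x + t *\<^sub>R v) *v v)) (at t)" for t
  proof -
    have "((\<lambda>t. grad V (x + t *\<^sub>R v) \<bullet> v) has_derivative (\<lambda>h. (Hess V (x + t *\<^sub>R v) *v (h *\<^sub>R v)) \<bullet> v)) (at t)"
      by (intro has_derivative_inner_left has_derivative_compose[OF line gV])
    then show ?thesis
      by (simp add: has_field_derivative_def matrix_vector_mult_scaleR inner_commute mult_commute_abs)
  qed
  have hv: "R * (v \<bullet> v) \<le> v \<bullet> (Hess V z *v v)" for z
    using hess[of z] unfolding loewner_le_def scaleR_matrix_vector_assoc[symmetric]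
    by (metis inner_scaleR_right matrix_vector_mul_lid)
  define q where "q t = V (x + t *\<^sub>R v) - t * (grad V x \<bullet> v) - R / 2 * t\<^sup>2 * (v \<bullet> v)" for t
  define q' where "q' t = grad V (x + t *\<^sub>R v) \<bullet> v - grad V x \<bullet> v - R * t * (v \<bullet> v)" for t
  have q: "(q has_real_derivative q' t) (at t)" for t
  proof -
    have "((\<lambda>t. t * (grad V x \<bullet> v) + R / 2 * t\<^sup>2 * (v \<bullet> v)) has_real_derivative
        grad V x \<bullet> v + R * t * (v \<bullet> v)) (at t)"
      by (auto intro!: derivative_eq_intros)
    from DERIV_diff[OF V1 this] show ?thesis
      by (simp add: q_def[abs_def] q'_def diff_diff_eq)
  qed
  have q': "(q' has_real_derivative v \<bullet> (Hess V (x + t *\<^sub>R v) *v v) - R * (v \<bullet> v)) (at t)" for t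
  proof -
    have "((\<lambda>t. grad V x \<bullet> v + R * t * (v \<bullet> v)) has_real_derivative R * (v \<bullet> v)) (at t)"
      by (auto intro!: derivative_eq_intros)
    from DERIV_diff[OF V2 this] show ?thesis
      by (simp add: q'_def[abs_def] diff_diff_eq)
  qed
  have "q' 0 \<le> q' t" if "0 \<le> t" for t
  proof (rule DERIV_nonneg_imp_nondecreasing[of 0 t q', OF that])
    fix t
    show "\<exists>d. (q' has_real_derivative d) (at t) \<and> 0 \<le> d"
      using q'[of t] hv[of "x + t *\<^sub>R v"] by (intro exI conjI) auto
  qed
  then have q'_nonneg: "0 \<le> q' t" if "0 \<le> t" for t
    using that by (simp add: q'_def)
  have "q 0 \<le> q 1"
  proof (rule DERIV_nonneg_imp_nondecreasing[of 0 1 q])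
    fix t :: real assume "0 \<le> t"
    then show "\<exists>d. (q has_real_derivative d) (at t) \<and> 0 \<le> d"
      using q q'_nonneg by blast
  qed simp
  then show ?thesis
    by (simp add: q_def v_def power2_norm_eq_inner)
qed

lemma bounded_if_compactly_supported:
  fixes H :: "real^'n \<Rightarrow> real"
  assumes "continuous_on UNIV H" "bounded {x. H x \<noteq> 0}"
  shows "\<exists>B. \<forall>x. \<bar>H x\<bar> \<le> B"
proof -
  have "compact (closure {x. H x \<noteq> 0})" using assms(2) by (simp add: compact_closure)
  then have "bounded (H ` closure {x. H x \<noteq> 0})"
    by (intro compact_imp_bounded compact_continuous_image continuous_on_subset[OF assms(1)]) auto
  then obtain B where B: "\<And>x. x \<in> closure {x. H x \<noteq> 0} \<Longrightarrow> norm (H x) \<le> B"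
    by (auto simp: bounded_iff)
  have "\<bar>H x\<bar> \<le> max B 0" for x
    using B[of x] closure_subset[of "{x. H x \<noteq> 0}"] by (cases "H x = 0") auto
  then show ?thesis by blast
qed

section \<open>Entropy and the Knothe map\<close>

lemma abs_x_ln_x_le:
  fixes x B :: real
  assumes "0 \<le> x" "x \<le> B"
  shows "\<bar>x * ln x\<bar> \<le> 1 + B\<^sup>2"
proof (cases "x = 0")
  case False
  with assms have x: "0 < x" by simp
  have "x * ln x \<le> x * x"
    using x ln_le_minus_one[OF x] by (intro mult_left_mono) auto
  also have "\<dots> \<le> B\<^sup>2"
    using assms by (simp add: power2_eq_square mult_mono)
  finally have "x * ln x \<le> B\<^sup>2" .
  moreover have "- (x * ln x) \<le> 1"
  proof -
    have "ln (1 / x) \<le> 1 / x - 1" using x by (intro ln_le_minus_one) auto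
    then have "x * ln (1 / x) \<le> x * (1 / x - 1)" using x by (intro mult_left_mono) auto
    then show ?thesis using x by (simp add: ln_div algebra_simps)
  qed
  ultimately show ?thesis by (smt (verit) zero_le_power2)
qed simp

context cube_density
begin

lemma integrable_P_bounded:
  fixes h :: "('n \<Rightarrow> real) \<Rightarrow> real"
  assumes "h \<in> borel_measurable borel" "\<And>x. (\<And>i. \<bar>x i\<bar> \<le> K) \<Longrightarrow> \<bar>h x\<bar> \<le> C"
  shows "integrable P h"
proof -
  interpret P: finite_measure P by (rule finite_measure_PiM_seg)
  show ?thesis
  proof (rule P.integrable_const_bound)
    show "h \<in> borel_measurable P" using assms(1) borel_measurable_cube by blast
    show "AE x in P. norm (h x) \<le> C"
      using AE_PiM_seg[of UNIV K] by eventually_elim (use assms(2) in auto)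
  qed
qed

text \<open>
  Take logarithms in the Monge-Ampere equation and bound each \<open>ln (d i)\<close> by the tangent line of
  the logarithm at \<open>1 / s\<close>, that is \<open>ln (d i) \<le> s * d i - 1 - ln s\<close>. After multiplication by \<open>F\<close>
  the derivatives occur linearly and are removed by integration by parts. Subtracting the same
  formula for the identity map produces the displacement \<open>T x - x\<close> and the summand \<open>s\<close> in the
  dimensional constant.
\<close>

lemma entropy_le_transport:
  assumes G: "continuous_on UNIV G" "\<And>y. 0 < G y" "\<And>y. \<bar>G y\<bar> \<le> B'"
    and lnG: "\<And>y. (\<And>i. \<bar>y i\<bar> \<le> K) \<Longrightarrow> \<bar>ln (G y)\<bar> \<le> C"
    and F1: "(\<integral>x. F x \<partial>P) = 1" and "0 < s"
  obtains T where "\<And>x i. \<bar>T x i\<bar> \<le> K"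
    and "integrable P (\<lambda>x. F x * ln (F x))"
    and "integrable P (\<lambda>x. F x * ln (G (T x)) - s * (\<Sum>i\<in>UNIV. D i x * (T x i - x i)))"
    and "(\<integral>x. F x * ln (F x) \<partial>P)
      \<le> (\<integral>x. F x * ln (G (T x)) - s * (\<Sum>i\<in>UNIV. D i x * (T x i - x i)) \<partial>P)
        + real CARD('n) * (s - 1 - ln s) - ln (\<integral>y. G y \<partial>P)"
proof -
  obtain T d where Td: "knothe_map G UNIV T d"
    using knothe_map_exists[OF G] by blast
  note T_meas = knothe_mapD(1)[OF Td] and T_bound = knothe_mapD(2)[OF Td]
    and Fd = knothe_mapD(4)[OF Td UNIV_I] and DT = knothe_mapD(5)[OF Td UNIV_I]
    and Fd_eq = knothe_mapD(6)[OF Td UNIV_I] and d_pos = knothe_mapD(7)[OF Td _ UNIV_I]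
  define Z where "Z = (\<integral>y. G y \<partial>P)"
  let ?n = "real CARD('n)"
  have Z_pos: "0 < Z"
    unfolding Z_def marg_UNIV[symmetric, where x = "\<lambda>_. 0"]
    using K_pos G(2) by (intro marg_pos[OF G(1,3)]) (auto intro: less_imp_le)
  have jac: "F x * Z = G (T x) * (\<Prod>i\<in>UNIV. d i x)" if "0 < F x" for x
    using knothe_mapD(8)[OF Td that] by (simp add: F1 marg_empty Z_def)
  have [measurable]: "F \<in> borel_measurable borel" "G \<in> borel_measurable borel" "T \<in> measurable borel borel"
    by (intro borel_measurable_continuous_onI cont_F G(1) measurable_coords T_meas)+
  have iF: "integrable P F"
    by (rule integrable_P_bounded) (auto intro: F_bound)
  have iFF: "integrable P (\<lambda>x. F x * ln (F x))"
    using F_nonneg F_bound by (intro integrable_P_bounded[of _ "1 + B\<^sup>2"] abs_x_ln_x_le) (auto simp: abs_le_iff)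
  have iFG: "integrable P (\<lambda>x. F x * ln (G (T x)))"
  proof (rule integrable_P_bounded)
    show "\<bar>F x * ln (G (T x))\<bar> \<le> B * C" for x
      unfolding abs_mult using lnG[of "T x"] T_bound F_bound by (intro mult_mono) (auto intro: order_trans[OF abs_ge_zero])
  qed measurable
  have coord: "integrable P (\<lambda>x. D i x * x i)" "(\<integral>x. D i x * x i \<partial>P) = - 1" for i
  proof -
    have "\<And>x t. continuous_on {-K..K} (\<lambda>t. (x(i := t)) i) \<and> continuous_on {-K..K} (\<lambda>t. 1 :: real) \<and>
      (\<forall>t\<in>{-K<..<K}. ((\<lambda>t. (x(i := t)) i) has_real_derivative 1) (at t))"
      by simp
    note parts = fiber_integration_by_parts[where \<tau> = "\<lambda>x. x i" and d = "\<lambda>_. 1" and a = i, OF _ _ _ _ this]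
    show "integrable P (\<lambda>x. D i x * x i)" by (rule parts(2)) auto
    have "(\<integral>x. F x * 1 \<partial>P) = - (\<integral>x. D i x * x i \<partial>P)" by (rule parts(3)) auto
    then show "(\<integral>x. D i x * x i \<partial>P) = - 1" using F1 by simp
  qed
  have disp: "integrable P (\<lambda>x. D i x * (T x i - x i))"
    "(\<integral>x. D i x * (T x i - x i) \<partial>P) = 1 - (\<integral>x. F x * d i x \<partial>P)" for i
    using DT[of i] coord[of i] Fd_eq[of i] by (simp_all add: right_diff_distrib)
  have iS: "integrable P (\<lambda>x. s * (\<Sum>i\<in>UNIV. D i x * (T x i - x i)))"
    by (intro integrable_mult_right Bochner_Integration.integrable_sum disp)
  have point: "F x * ln (F x) \<le> F x * ln (G (T x)) + (- ln Z - ?n * (1 + ln s)) * F x + s * (\<Sum>i\<in>UNIV. F x * d i x)" for x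
  proof (cases "F x = 0")
    case False
    then have Fx: "0 < F x" using F_nonneg[of x] by simp
    have d: "0 < d i x" "d i x \<noteq> 0" for i using d_pos[OF Fx, of i] by auto
    have "ln (F x) + ln Z = ln (G (T x)) + (\<Sum>i\<in>UNIV. ln (d i x))"
      using arg_cong[OF jac[OF Fx], of ln] Fx Z_pos G(2)[of "T x"] d
      by (simp add: ln_mult ln_prod prod_pos)
    moreover have "ln (d i x) \<le> s * d i x - (1 + ln s)" for i
      using ln_le_minus_one[of "s * d i x"] d(1)[of i] \<open>0 < s\<close> by (simp add: ln_mult)
    then have "(\<Sum>i\<in>UNIV. ln (d i x)) \<le> (\<Sum>i\<in>UNIV. s * d i x - (1 + ln s))"
      by (intro sum_mono)
    ultimately have "ln (F x) \<le> ln (G (T x)) - ln Z + (s * (\<Sum>i\<in>UNIV. d i x) - ?n * (1 + ln s))"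
      by (simp add: sum_subtractf sum_distrib_left)
    from mult_left_mono[OF this F_nonneg[of x]] show ?thesis
      by (simp add: algebra_simps sum_distrib_left)
  qed simp
  have iFds: "integrable P (\<lambda>x. s * (\<Sum>i\<in>UNIV. F x * d i x))"
    by (intro integrable_mult_right Bochner_Integration.integrable_sum Fd)
  have "(\<integral>x. F x * ln (F x) \<partial>P)
    \<le> (\<integral>x. F x * ln (G (T x)) + (- ln Z - ?n * (1 + ln s)) * F x + s * (\<Sum>i\<in>UNIV. F x * d i x) \<partial>P)"
    by (intro integral_mono iFF Bochner_Integration.integrable_add iFG iFds integrable_mult_right iF point)
  also have "\<dots> = (\<integral>x. F x * ln (G (T x)) \<partial>P) + (- ln Z - ?n * (1 + ln s)) + s * (\<Sum>i\<in>UNIV. \<integral>x. F x * d i x \<partial>P)"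
    using iFG iFds iF F1 Fd by (simp add: Bochner_Integration.integral_sum)
  also have "\<dots> = (\<integral>x. F x * ln (G (T x)) \<partial>P) - s * (\<Sum>i\<in>UNIV. \<integral>x. D i x * (T x i - x i) \<partial>P)
     + ?n * (s - 1 - ln s) - ln Z"
    by (simp only: disp(2) sum_subtractf) (simp add: algebra_simps)
  also have "(\<integral>x. F x * ln (G (T x)) \<partial>P) - s * (\<Sum>i\<in>UNIV. \<integral>x. D i x * (T x i - x i) \<partial>P)
    = (\<integral>x. F x * ln (G (T x)) - s * (\<Sum>i\<in>UNIV. D i x * (T x i - x i)) \<partial>P)"
    using iFG iS disp(1) by (simp add: Bochner_Integration.integral_sum)
  finally show thesis
    using T_bound iFF iFG iS by (intro that[of T]) (auto simp: Z_def)
qed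

end

section \<open>The logarithmic Sobolev inequality\<close>

lemma continuous_on_UNIV_vec_lambda:
  fixes H :: "real^'n \<Rightarrow> real"
  assumes "continuous_on UNIV H"
  shows "continuous_on UNIV (\<lambda>y. H (vec_lambda y))"
  by (intro continuous_on_compose2[OF assms] continuous_on_vec_lambda continuous_on_product_coordinates) auto

lemma C1_imp_continuous:
  assumes "C1 f"
  shows "continuous_on UNIV f" "continuous_on UNIV (grad f)"
  using assms by (auto simp: C1_def intro!: continuous_at_imp_continuous_on differentiable_imp_continuous_within)

lemma inner_Young:
  fixes a b :: "'a::real_inner"
  assumes "0 < R"
  shows "0 \<le> (norm a)\<^sup>2 / (2 * R) + a \<bullet> b + R / 2 * (norm b)\<^sup>2"
proof -
  have "0 \<le> (norm (a + R *\<^sub>R b))\<^sup>2 / (2 * R)" using assms by simp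
  also have "(norm (a + R *\<^sub>R b))\<^sup>2 = a \<bullet> a + 2 * R * (a \<bullet> b) + R\<^sup>2 * (b \<bullet> b)"
    unfolding power2_norm_eq_inner
    by (simp add: inner_add_left inner_add_right inner_commute power2_eq_square algebra_simps)
  finally show ?thesis
    using assms unfolding power2_norm_eq_inner by (simp add: field_simps power2_eq_square)
qed

text \<open>
  The target is \<open>exp (- V)\<close> restricted to the cube, so that the Knothe map is bounded; its missing
  mass accounts for the last logarithm. Strong convexity bounds \<open>- V\<close> at the image point by a
  concave quadratic function of the displacement, and completing the square eliminates the
  displacement pointwise. What remains no longer refers to the map.
\<close>

lemma log_sobolev_on_cube:
  fixes V f :: "real^'n \<Rightarrow> real"
  assumes V: "C2 V" and "0 < R" and hess: "\<And>x. loewner_le (R *\<^sub>R mat 1) (Hess V x)"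
    and "0 < s" and f: "C1 f" "\<And>x. 0 \<le> f x" and "0 < K" and supp: "\<And>x i. K \<le> \<bar>x $ i\<bar> \<Longrightarrow> f x = 0"
    and norm1: "(\<integral>x. exp (- V x) * (f x)\<^sup>2 \<partial>lborel) = 1"
  defines "w \<equiv> \<lambda>x. ((1 - s) * f x) *\<^sub>R grad V x + (2 * s) *\<^sub>R grad f x"
  shows "(\<integral>x. exp (- V x) * ((f x)\<^sup>2 * ln ((f x)\<^sup>2)) \<partial>lborel)
    \<le> real CARD('n) * (s - 1 - ln s) + 1 / (2 * R) * (\<integral>x. exp (- V x) * (norm (w x))\<^sup>2 \<partial>lborel)
      - ln (\<integral>x. indicator {x. \<forall>i. \<bar>x $ i\<bar> \<le> K} x * exp (- V x) \<partial>lborel)"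
proof -
  define F where "F x = exp (- V x) * (f x)\<^sup>2" for x
  define D where "D i x = exp (- V x) * (2 * f x * grad f x $ i - (f x)\<^sup>2 * grad V x $ i)" for i x
  define W where "W x = exp (- V x) * (norm (w x))\<^sup>2" for x
  define L where "L x = exp (- V x) * ((f x)\<^sup>2 * ln ((f x)\<^sup>2))" for x
  have CV: "C1 V" using V by (simp add: C2_def)
  have diff: "f differentiable at x" "V differentiable at x" for x
    using f(1) CV by (auto simp: C1_def)
  note cont [continuous_intros] = C1_imp_continuous[OF f(1)] C1_imp_continuous[OF CV]
  have cF: "continuous_on UNIV F" and cD: "\<And>i. continuous_on UNIV (D i)" and cW: "continuous_on UNIV W"
    unfolding F_def D_def W_def w_def by (intro continuous_intros)+
  have grad0: "grad f x = 0" if "f x = 0" for x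
    using grad_minimum_zero[OF diff(1) f(2) that] .
  have out: "f x = 0" if "\<not> (\<forall>i. \<bar>x $ i\<bar> \<le> K)" for x
    using supp that by (metis less_imp_le not_le)
  have restrict: "(\<integral>y. H (vec_lambda y) \<partial>PiM UNIV (\<lambda>_. seg K)) = (\<integral>x. H x \<partial>lborel)"
    if "H \<in> borel_measurable borel" "\<And>x. f x = 0 \<Longrightarrow> H x = 0" for H :: "real^'n \<Rightarrow> real"
    unfolding integral_cube[OF that(1)] using out that(2)
    by (intro Bochner_Integration.integral_cong) (auto simp: indicator_def)
  have bdd_supp: "bounded {x. H x \<noteq> 0}" if "\<And>x. f x = 0 \<Longrightarrow> H x = 0" for H :: "real^'n \<Rightarrow> real"
  proof (rule bounded_subset)
    show "bounded (cbox (\<chi> i. -K) (\<chi> i. K) :: (real^'n) set)" by (rule bounded_cbox)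
    have "\<bar>x $ i\<bar> \<le> K" if "H x \<noteq> 0" for x i
      using supp[of x i] \<open>f x = 0 \<Longrightarrow> H x = 0\<close> that by (metis less_imp_le not_le)
    then show "{x. H x \<noteq> 0} \<subseteq> cbox (\<chi> i. -K) (\<chi> i. K)"
      by (auto simp: mem_box_cart abs_le_iff) (metis minus_le_iff)
  qed
  obtain BF where BF: "\<And>x. \<bar>F x\<bar> \<le> BF"
    using bounded_if_compactly_supported[OF cF bdd_supp] by (auto simp: F_def)
  have "\<exists>B. \<forall>x. \<bar>D i x\<bar> \<le> B" for i
    by (intro bounded_if_compactly_supported cD bdd_supp) (simp add: D_def)
  then obtain BD where BD: "\<And>i x. \<bar>D i x\<bar> \<le> BD i" by metis
  define B where "B = BF + (\<Sum>i\<in>UNIV. BD i)"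
  have "0 \<le> BF" using BF[of 0] by linarith
  have "0 \<le> BD i" for i using BD[of i 0] by linarith
  have B: "\<bar>F x\<bar> \<le> B" "\<bar>D i x\<bar> \<le> B" for x i
  proof -
    have "BD i \<le> (\<Sum>i\<in>UNIV. BD i)"
      using \<open>\<And>i. 0 \<le> BD i\<close> by (intro member_le_sum) auto
    moreover have "0 \<le> (\<Sum>i\<in>UNIV. BD i)"
      using \<open>\<And>i. 0 \<le> BD i\<close> by (intro sum_nonneg) auto
    ultimately show "\<bar>F x\<bar> \<le> B" "\<bar>D i x\<bar> \<le> B"
      using BF[of x] BD[of i x] \<open>0 \<le> BF\<close> by (auto simp: B_def)
  qed
  have F_ge_0: "0 \<le> F x" for x by (simp add: F_def)
  interpret cube_density K "\<lambda>y. F (vec_lambda y)" "\<lambda>i y. D i (vec_lambda y)" B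
  proof
    fix x :: "'n \<Rightarrow> real" and i
    show "F (vec_lambda x) = 0" if "K \<le> \<bar>x i\<bar>"
      using supp[of "vec_lambda x" i] that by (simp add: F_def)
    have d: "((\<lambda>t. V (vec_lambda (x(i := t)))) has_real_derivative grad V (vec_lambda x) $ i) (at (x i))"
      "((\<lambda>t. f (vec_lambda (x(i := t)))) has_real_derivative grad f (vec_lambda x) $ i) (at (x i))"
      by (intro has_derivative_coordinate diff)+
    show "((\<lambda>t. F (vec_lambda (x(i := t)))) has_real_derivative D i (vec_lambda x)) (at (x i))"
      unfolding F_def D_def
      by (rule DERIV_cong[OF DERIV_mult[OF DERIV_fun_exp[OF DERIV_minus[OF d(1)]] DERIV_power[OF d(2)]]])
         (simp add: algebra_simps power2_eq_square)
  qed (use B \<open>0 < K\<close> in \<open>auto intro!: continuous_on_UNIV_vec_lambda cF cD F_ge_0\<close>)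

  \<comment> \<open>A quadratic lower bound for \<open>V\<close> at the origin makes the target density \<open>exp (- V)\<close> bounded.\<close>
  have V_lower: "V 0 - (norm (grad V 0))\<^sup>2 / (2 * R) \<le> V x" for x
  proof -
    have "- (norm (grad V 0))\<^sup>2 / (2 * R) \<le> grad V 0 \<bullet> x + R / 2 * (norm x)\<^sup>2"
      using inner_Young[OF \<open>0 < R\<close>, of "grad V 0" x] by simp
    then show ?thesis using strong_convexity[OF V hess, of 0 x] by simp
  qed
  obtain C where C: "\<And>x. (\<And>i. \<bar>x $ i\<bar> \<le> K) \<Longrightarrow> \<bar>V x\<bar> \<le> C"
  proof -
    let ?C = "cbox (\<chi> i. -K) (\<chi> i. K) :: (real^'n) set"
    have "bounded (V ` ?C)"
      by (intro compact_imp_bounded compact_continuous_image continuous_on_subset[OF cont(3)]) auto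
    then obtain C where C: "\<And>x. x \<in> ?C \<Longrightarrow> \<bar>V x\<bar> \<le> C"
      by (auto simp: bounded_iff)
    have "x \<in> ?C" if "\<And>i. \<bar>x $ i\<bar> \<le> K" for x :: "real^'n"
      using that by (auto simp: mem_box_cart abs_le_iff) (metis minus_le_iff)
    then show thesis using C by (intro that[of C]) blast
  qed
  have meas: "F \<in> borel_measurable borel" "W \<in> borel_measurable borel" "L \<in> borel_measurable borel"
    "(\<lambda>x. exp (- V x)) \<in> borel_measurable borel"
  proof -
    have [measurable]: "f \<in> borel_measurable borel" "V \<in> borel_measurable borel"
      by (intro borel_measurable_continuous_onI cont)+
    show "F \<in> borel_measurable borel" "W \<in> borel_measurable borel" by (intro borel_measurable_continuous_onI cF cW)+
    show "L \<in> borel_measurable borel" "(\<lambda>x. exp (- V x)) \<in> borel_measurable borel"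
      unfolding L_def by measurable
  qed
  define Z where "Z = (\<integral>x. indicator {x. \<forall>i. \<bar>x $ i\<bar> \<le> K} x * exp (- V x) \<partial>lborel)"
  obtain T where T: "\<And>x i. \<bar>T x i\<bar> \<le> K"
    and i1: "integrable P (\<lambda>y. F (vec_lambda y) * ln (F (vec_lambda y)))"
    and i2: "integrable P (\<lambda>y. F (vec_lambda y) * ln (exp (- V (vec_lambda (T y))))
               - s * (\<Sum>i\<in>UNIV. D i (vec_lambda y) * (T y i - y i)))"
    and le: "(\<integral>y. F (vec_lambda y) * ln (F (vec_lambda y)) \<partial>P)
      \<le> (\<integral>y. F (vec_lambda y) * ln (exp (- V (vec_lambda (T y))))
               - s * (\<Sum>i\<in>UNIV. D i (vec_lambda y) * (T y i - y i)) \<partial>P)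
        + real CARD('n) * (s - 1 - ln s) - ln (\<integral>y. exp (- V (vec_lambda y)) \<partial>P)"
  proof (rule entropy_le_transport)
    show "continuous_on UNIV (\<lambda>y. exp (- V (vec_lambda y)))"
      by (intro continuous_on_UNIV_vec_lambda[of "\<lambda>x. exp (- V x)"] continuous_intros)
    show "\<bar>exp (- V (vec_lambda y))\<bar> \<le> exp (- (V 0 - (norm (grad V 0))\<^sup>2 / (2 * R)))" for y
      using V_lower[of "vec_lambda y"] by simp
    show "\<bar>ln (exp (- V (vec_lambda y)))\<bar> \<le> C" if "\<And>i. \<bar>y i\<bar> \<le> K" for y
      using C[of "vec_lambda y"] that by simp
    show "(\<integral>y. F (vec_lambda y) \<partial>P) = 1"
      using restrict[OF meas(1)] norm1 by (simp add: F_def)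
  qed (use \<open>0 < s\<close> in auto)

  have FV: "integrable P (\<lambda>y. F (vec_lambda y) * V (vec_lambda y))"
    by (intro integrable_cube[of "\<lambda>x. F x * V x"] continuous_intros cF)
  have WP: "integrable P (\<lambda>y. W (vec_lambda y))"
    by (intro integrable_cube cW)
  have FlnF: "F x * ln (F x) = L x - F x * V x" for x
    by (cases "f x = 0") (auto simp: F_def L_def ln_mult algebra_simps)
  have point: "F (vec_lambda y) * ln (exp (- V (vec_lambda (T y))))
        - s * (\<Sum>i\<in>UNIV. D i (vec_lambda y) * (T y i - y i))
      \<le> 1 / (2 * R) * W (vec_lambda y) - F (vec_lambda y) * V (vec_lambda y)" for y
  proof -
    define x where "x = (vec_lambda y :: real^'n)"
    define \<theta> where "\<theta> = vec_lambda (T y) - x"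
    have sum: "(\<Sum>i\<in>UNIV. D i x * (T y i - y i)) = exp (- V x) * (2 * f x * (grad f x \<bullet> \<theta>) - (f x)\<^sup>2 * (grad V x \<bullet> \<theta>))"
      by (simp add: D_def inner_vec_def \<theta>_def x_def sum_distrib_left sum_subtractf[symmetric] algebra_simps)
    have "V x + grad V x \<bullet> \<theta> + R / 2 * (norm \<theta>)\<^sup>2 \<le> V (vec_lambda (T y))"
      using strong_convexity[OF V hess, of x "vec_lambda (T y)"] by (simp add: \<theta>_def)
    then have "(f x)\<^sup>2 * (V x + grad V x \<bullet> \<theta> + R / 2 * (norm \<theta>)\<^sup>2) \<le> (f x)\<^sup>2 * V (vec_lambda (T y))"
      by (rule mult_left_mono) simp
    moreover have "0 \<le> (norm (w x))\<^sup>2 / (2 * R) + f x * (w x \<bullet> \<theta>) + R / 2 * (f x)\<^sup>2 * (norm \<theta>)\<^sup>2"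
      using inner_Young[OF \<open>0 < R\<close>, of "w x" "f x *\<^sub>R \<theta>"] by (simp add: power_mult_distrib mult_ac)
    moreover have "w x \<bullet> \<theta> = (1 - s) * f x * (grad V x \<bullet> \<theta>) + 2 * s * (grad f x \<bullet> \<theta>)"
      by (simp add: w_def inner_add_left)
    ultimately have "- ((f x)\<^sup>2 * V (vec_lambda (T y))) - s * (2 * f x * (grad f x \<bullet> \<theta>) - (f x)\<^sup>2 * (grad V x \<bullet> \<theta>))
        \<le> (norm (w x))\<^sup>2 / (2 * R) - (f x)\<^sup>2 * V x"
      by (simp add: algebra_simps power2_eq_square)
    from mult_left_mono[OF this, of "exp (- V x)"] show ?thesis
      unfolding x_def[symmetric] sum F_def W_def by (simp add: algebra_simps)
  qed
  have LP: "integrable P (\<lambda>y. L (vec_lambda y))"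
    using Bochner_Integration.integrable_add[OF i1 FV] by (simp add: FlnF)
  have lhs: "(\<integral>y. F (vec_lambda y) * ln (F (vec_lambda y)) \<partial>P)
      = (\<integral>y. L (vec_lambda y) \<partial>P) - (\<integral>y. F (vec_lambda y) * V (vec_lambda y) \<partial>P)"
    unfolding FlnF by (rule Bochner_Integration.integral_diff[OF LP FV])
  have "(\<integral>y. F (vec_lambda y) * ln (exp (- V (vec_lambda (T y))))
               - s * (\<Sum>i\<in>UNIV. D i (vec_lambda y) * (T y i - y i)) \<partial>P)
      \<le> (\<integral>y. 1 / (2 * R) * W (vec_lambda y) - F (vec_lambda y) * V (vec_lambda y) \<partial>P)"
    by (intro integral_mono i2 point Bochner_Integration.integrable_diff integrable_mult_right WP FV)
  also have "\<dots> = 1 / (2 * R) * (\<integral>y. W (vec_lambda y) \<partial>P) - (\<integral>y. F (vec_lambda y) * V (vec_lambda y) \<partial>P)"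
    using WP FV by simp
  finally have rhs: "(\<integral>y. F (vec_lambda y) * ln (exp (- V (vec_lambda (T y))))
               - s * (\<Sum>i\<in>UNIV. D i (vec_lambda y) * (T y i - y i)) \<partial>P)
      \<le> 1 / (2 * R) * (\<integral>y. W (vec_lambda y) \<partial>P) - (\<integral>y. F (vec_lambda y) * V (vec_lambda y) \<partial>P)" .
  have Z: "(\<integral>y. exp (- V (vec_lambda y)) \<partial>P) = Z"
    unfolding Z_def by (rule integral_cube[OF meas(4)])
  have W: "(\<integral>y. W (vec_lambda y) \<partial>P) = (\<integral>x. W x \<partial>lborel)"
    by (intro restrict meas) (simp add: W_def w_def grad0)
  have L: "(\<integral>y. L (vec_lambda y) \<partial>P) = (\<integral>x. L x \<partial>lborel)"
    by (intro restrict meas) (simp add: L_def)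
  have "(\<integral>x. L x \<partial>lborel)
      \<le> real CARD('n) * (s - 1 - ln s) + 1 / (2 * R) * (\<integral>x. W x \<partial>lborel) - ln Z"
    using le[unfolded Z lhs L] rhs[unfolded W] by linarith
  then show ?thesis unfolding L_def W_def Z_def .
qed

lemma density_exp_integral:
  fixes V :: "real^'n \<Rightarrow> real" and h :: "real^'n \<Rightarrow> real"
  assumes "V \<in> borel_measurable borel" "h \<in> borel_measurable borel"
  shows "(\<integral>x. h x \<partial>density lborel (\<lambda>x. ennreal (exp (- V x)))) = (\<integral>x. exp (- V x) * h x \<partial>lborel)"
  using assms by (subst integral_density) auto

lemma measure_cubes_tendsto_1:
  fixes M :: "(real^'n) measure"
  assumes "prob_space M" "sets M = sets borel"
  shows "(\<lambda>n. measure M {x. \<forall>i. \<bar>x $ i\<bar> \<le> real n}) \<longlonglongrightarrow> 1"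
proof -
  interpret prob_space M by fact
  let ?Q = "\<lambda>n. {x :: real^'n. \<forall>i. \<bar>x $ i\<bar> \<le> real n}"
  have "range ?Q \<subseteq> sets M"
    unfolding assms(2) by (auto intro!: borel_closed closed_Collect_all closed_Collect_le continuous_intros)
  moreover have "incseq ?Q" by (auto simp: incseq_def intro: order_trans)
  ultimately have "(\<lambda>n. measure M (?Q n)) \<longlonglongrightarrow> measure M (\<Union>n. ?Q n)"
    by (rule finite_Lim_measure_incseq)
  also have "(\<Union>n. ?Q n) = space M"
  proof -
    have "\<exists>n. \<forall>i. \<bar>x $ i\<bar> \<le> real n" for x :: "real^'n"
      using real_arch_simple[of "norm x"] component_le_norm_cart[of x] by (meson order_trans)
    then show ?thesis using sets_eq_imp_space_eq[OF assms(2)] by auto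
  qed
  finally show ?thesis by (simp add: prob_space)
qed

theorem corollary1p4:
  fixes \<mu> :: "(real ^ 'n) measure"
    and V :: "real ^ 'n \<Rightarrow> real"
    and f :: "real ^ 'n \<Rightarrow> real"
    and R s :: real
  assumes "prob_space \<mu>"
    and "\<mu> = density lborel (\<lambda>x. ennreal (exp (- V x)))"
    and "C2 V"
    and "R > 0"
    and "\<And>x. loewner_le (R *\<^sub>R mat 1) (Hess V x)"
    and "s > 0"
    and "C1 f"
    and "\<And>x. 0 \<le> f x"
    and "compactly_supported f"
    and "(\<integral>x. (f x)\<^sup>2 \<partial>\<mu>) = 1"
  shows "Ent \<mu> (\<lambda>x. (f x)\<^sup>2)
    \<le> real CARD('n) * (s - 1 - ln s)
      + 1 / (2 * R) * (\<integral>x. (norm (((1 - s) * f x) *\<^sub>R grad V x + (2 * s) *\<^sub>R grad f x))\<^sup>2 \<partial>\<mu>)"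
proof -
  let ?w = "\<lambda>x. ((1 - s) * f x) *\<^sub>R grad V x + (2 * s) *\<^sub>R grad f x"
  let ?Q = "\<lambda>n. {x :: real^'n. \<forall>i. \<bar>x $ i\<bar> \<le> real n}"
  have "C1 V" using assms(3) by (simp add: C2_def)
  note cont [continuous_intros] = C1_imp_continuous[OF assms(7)] C1_imp_continuous[OF this]
  have [measurable]: "V \<in> borel_measurable borel" "f \<in> borel_measurable borel"
    "(\<lambda>x. (norm (?w x))\<^sup>2) \<in> borel_measurable borel"
    by (rule borel_measurable_continuous_onI; intro continuous_intros)+
  have [measurable]: "?Q n \<in> sets borel" for n
    by (intro borel_closed closed_Collect_all closed_Collect_le continuous_intros)
  note to_lborel = density_exp_integral[of V, folded assms(2)]
  have "compact (closure {x. f x \<noteq> 0})" using assms(9) by (simp add: compactly_supported_def)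
  then have "bounded {x. f x \<noteq> 0}"
    by (intro bounded_subset[OF compact_imp_bounded closure_subset])
  then obtain b where b: "\<And>x. f x \<noteq> 0 \<Longrightarrow> norm x \<le> b"
    by (auto simp: bounded_iff)
  obtain N :: nat where N: "max b 0 < N" using reals_Archimedean2 by blast
  define rhs where "rhs = real CARD('n) * (s - 1 - ln s) + 1 / (2 * R) * (\<integral>x. (norm (?w x))\<^sup>2 \<partial>\<mu>)"
  have bound: "Ent \<mu> (\<lambda>x. (f x)\<^sup>2) \<le> rhs - ln (measure \<mu> (?Q n))" if "N \<le> n" for n
  proof -
    have supp: "f x = 0" if "real n \<le> \<bar>x $ i\<bar>" for x i
    proof (rule ccontr)
      assume "f x \<noteq> 0"
      then have "norm x \<le> b" by (rule b)
      with component_le_norm_cart[of x i] that N \<open>N \<le> n\<close> show False by linarith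
    qed
    have "0 < real n" using N that by simp
    moreover have "(\<integral>x. exp (- V x) * (f x)\<^sup>2 \<partial>lborel) = 1"
      using assms(10) by (simp add: to_lborel)
    ultimately have "(\<integral>x. exp (- V x) * ((f x)\<^sup>2 * ln ((f x)\<^sup>2)) \<partial>lborel)
      \<le> real CARD('n) * (s - 1 - ln s) + 1 / (2 * R) * (\<integral>x. exp (- V x) * (norm (?w x))\<^sup>2 \<partial>lborel)
        - ln (\<integral>x. indicator (?Q n) x * exp (- V x) \<partial>lborel)"
      using supp by (intro log_sobolev_on_cube[OF assms(3-8)])
    moreover have "(\<integral>x. indicator (?Q n) x * exp (- V x) \<partial>lborel) = measure \<mu> (?Q n)"
    proof -
      have "(\<integral>x. exp (- V x) * indicator (?Q n) x \<partial>lborel) = (\<integral>x. indicator (?Q n) x \<partial>\<mu>)"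
        by (rule to_lborel[symmetric]) auto
      also have "\<dots> = measure \<mu> (?Q n)"
        using assms(2) by simp
      finally show ?thesis by (simp add: mult.commute)
    qed
    moreover have "Ent \<mu> (\<lambda>x. (f x)\<^sup>2) = (\<integral>x. (f x)\<^sup>2 * ln ((f x)\<^sup>2) \<partial>\<mu>)"
      by (rule Ent_normalized[OF assms(10)])
    ultimately show ?thesis by (simp add: to_lborel rhs_def)
  qed
  have "(\<lambda>n. measure \<mu> (?Q n)) \<longlonglongrightarrow> 1"
    using assms(1,2) by (intro measure_cubes_tendsto_1) auto
  then have "(\<lambda>n. rhs - ln (measure \<mu> (?Q n))) \<longlonglongrightarrow> rhs - ln 1"
    by (intro tendsto_intros) auto
  then have "Ent \<mu> (\<lambda>x. (f x)\<^sup>2) \<le> rhs - ln 1"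
    by (rule LIMSEQ_le_const) (use bound in blast)
  then show ?thesis by (simp add: rhs_def)
qed

end
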